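(* For integers $n\ge1$ and $x\ge1$, let $P_1^n$ denote the graph consisting of $n$ disjoint copies of $P_1$ (i.e. $n$ isolated vertices) and $P_x^n$ the graph consisting of $n$ disjoint copies of $P_x$. Then $$\mu(P_1^n,P_x^n)=\begin{cases}(-1)^{x+n}, & \text{if } n=1 \text{ or } x=4,\\ 1, & \text{if } x=1 \text{ or } x=3,\\ 0, & \text{if } x=2 \text{ and } n>1,\\ \mathcal{F}_{x-2}, & \text{if } n=2,\\ \mathcal{C}_n, & \text{if } x=5,\end{cases}$$ where $\mathcal{F}_i$ is the $i$-th Fibonacci number and $\mathcal{C}_n$ the $n$-th Catalan number.
   Context: $\mathcal{G}$ is the poset of all finite unlabelled graphs (loops and multiple edges allowed), up to isomorphism, with $H\le G$ iff $H$ is isomorphic to an induced subgraph of $G$. $\mu$ is the Möbius function of $\mathcal{G}$: $\mu(a,a)=1$, $\mu(a,b)=0$ if $a\not\le b$, and $\mu(a,b)=-\sum_{a\le c<b}\mu(a,c)$ if $a<b$. $P_a$ denotes the path graph with $a$ vertices. Fibonacci numbers: $\mathcal{F}_0=0,\mathcal{F}_1=1,\mathcal{F}_{i}=\mathcal{F}_{i-1}+\mathcal{F}_{i-2}$. Catalan numbers: $\mathcal{C}_n=\frac{1}{n+1}\binom{2n}{n}$. *)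

theory Defs
  imports "HOL-Library.Multiset" "HOL-Library.Uprod" "HOL-Library.Nat_Bijection"
    "HOL-Number_Theory.Fib"
begin

text \<open>An edge is an unordered pair of vertices; \<^term>\<open>Upair v v\<close> is a loop at \<^term>\<open>v\<close>.\<close>

datatype 'a multigraph = Multigraph (verts: "'a set") (edges: "'a uprod multiset")

definition finite_graph :: "'a multigraph \<Rightarrow> bool" where
  "finite_graph G \<longleftrightarrow> finite (verts G) \<and> (\<forall>e\<in>#edges G. set_uprod e \<subseteq> verts G)"

definition map_graph :: "('a \<Rightarrow> 'b) \<Rightarrow> 'a multigraph \<Rightarrow> 'b multigraph" where
  "map_graph f G = Multigraph (f ` verts G) (image_mset (map_uprod f) (edges G))"

definition induce :: "'a multigraph \<Rightarrow> 'a set \<Rightarrow> 'a multigraph" where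
  "induce G W = Multigraph W (filter_mset (\<lambda>e. set_uprod e \<subseteq> W) (edges G))"

definition graph_iso :: "'a multigraph \<Rightarrow> 'b multigraph \<Rightarrow> bool" where
  "graph_iso G H \<longleftrightarrow> finite_graph G \<and> finite_graph H \<and>
     (\<exists>f. inj_on f (verts G) \<and> H = map_graph f G)"

definition induced_subgraph_of :: "'a multigraph \<Rightarrow> 'b multigraph \<Rightarrow> bool" where
  "induced_subgraph_of H G \<longleftrightarrow> (\<exists>W \<subseteq> verts G. graph_iso H (induce G W))"

definition path :: "nat \<Rightarrow> nat multigraph" where
  "path a = Multigraph {..<a} {#Upair i (Suc i). i \<in># mset_set {i. Suc i < a}#}"

text \<open>In a disjoint union of \<^term>\<open>n\<close> copies, the vertex \<^term>\<open>v\<close> of the copy number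
  \<^term>\<open>k\<close> is the pair \<^term>\<open>(k, v)\<close>, encoded as a natural number.\<close>

definition disjoint_copies :: "nat \<Rightarrow> nat multigraph \<Rightarrow> nat multigraph" where
  "disjoint_copies n G = Multigraph
     (\<Union>k<n. (\<lambda>v. prod_encode (k, v)) ` verts G)
     (\<Sum>k<n. image_mset (map_uprod (\<lambda>v. prod_encode (k, v))) (edges G))"

lemma verts_map_graph [simp]: "verts (map_graph f G) = f ` verts G"
  by (simp add: map_graph_def)

lemma edges_map_graph [simp]: "edges (map_graph f G) = image_mset (map_uprod f) (edges G)"
  by (simp add: map_graph_def)

lemma verts_induce [simp]: "verts (induce G W) = W"
  by (simp add: induce_def)

lemma edges_induce [simp]: "edges (induce G W) = filter_mset (\<lambda>e. set_uprod e \<subseteq> W) (edges G)"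
  by (simp add: induce_def)

lemma finite_graph_map: "finite_graph G \<Longrightarrow> finite_graph (map_graph f G)"
  by (auto simp: finite_graph_def uprod.set_map)

lemma finite_graph_induce: "finite_graph G \<Longrightarrow> W \<subseteq> verts G \<Longrightarrow> finite_graph (induce G W)"
  by (auto simp: finite_graph_def intro: finite_subset)

lemma map_graph_comp: "map_graph g (map_graph f G) = map_graph (g \<circ> f) G"
  by (simp add: map_graph_def image_comp multiset.map_comp uprod.map_comp comp_def)

lemma map_graph_cong:
  assumes "finite_graph G" "\<And>v. v \<in> verts G \<Longrightarrow> f v = g v"
  shows "map_graph f G = map_graph g G"
proof -
  have "image_mset (map_uprod f) (edges G) = image_mset (map_uprod g) (edges G)"
    using assms unfolding finite_graph_def
    by (intro image_mset_cong uprod.map_cong0) blast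
  moreover have "f ` verts G = g ` verts G" using assms(2) by auto
  ultimately show ?thesis by (simp add: map_graph_def)
qed

lemma map_graph_id: "map_graph (\<lambda>x. x) G = G"
  by (cases G) (simp add: map_graph_def uprod.map_id0[unfolded id_def])

lemma graph_iso_refl: "finite_graph G \<Longrightarrow> graph_iso G G"
  unfolding graph_iso_def using map_graph_id[of G] by (metis inj_on_id2)

lemma graph_iso_sym:
  assumes "graph_iso G H" shows "graph_iso H G"
proof -
  obtain f where f: "finite_graph G" "finite_graph H" "inj_on f (verts G)" "H = map_graph f G"
    using assms by (auto simp: graph_iso_def)
  let ?g = "inv_into (verts G) f"
  have "map_graph ?g H = map_graph (\<lambda>x. x) G"
    unfolding f(4) map_graph_comp using f by (intro map_graph_cong) auto
  moreover have "inj_on ?g (verts H)" using f by (simp add: inj_on_inv_into)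
  ultimately show ?thesis using f unfolding graph_iso_def map_graph_id by metis
qed

lemma graph_iso_trans:
  assumes "graph_iso G H" "graph_iso H K" shows "graph_iso G K"
proof -
  obtain f where f: "finite_graph G" "inj_on f (verts G)" "H = map_graph f G"
    using assms by (auto simp: graph_iso_def)
  obtain g where g: "finite_graph K" "inj_on g (verts H)" "K = map_graph g H"
    using assms by (auto simp: graph_iso_def)
  have "K = map_graph (g \<circ> f) G" using f g by (simp add: map_graph_comp)
  moreover have "inj_on (g \<circ> f) (verts G)" using f g by (simp add: comp_inj_on)
  ultimately show ?thesis using f g unfolding graph_iso_def by blast
qed

lemma graph_iso_card: "graph_iso G H \<Longrightarrow> card (verts G) = card (verts H)"
  by (auto simp: graph_iso_def card_image)

lemma induce_verts: "finite_graph G \<Longrightarrow> induce G (verts G) = G"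
  by (cases G) (auto simp: induce_def finite_graph_def filter_mset_eq_conv)

lemma induce_induce: "W \<subseteq> U \<Longrightarrow> induce (induce G U) W = induce G W"
proof -
  assume "W \<subseteq> U"
  then have "(\<lambda>e. set_uprod e \<subseteq> W \<and> set_uprod e \<subseteq> U) = (\<lambda>e. set_uprod e \<subseteq> W)" by auto
  then show ?thesis by (simp add: induce_def filter_filter_mset conj_commute)
qed

lemma induce_map_graph:
  assumes "finite_graph G" "inj_on f (verts G)" "W \<subseteq> verts G"
  shows "induce (map_graph f G) (f ` W) = map_graph f (induce G W)"
proof -
  have "set_uprod (map_uprod f e) \<subseteq> f ` W \<longleftrightarrow> set_uprod e \<subseteq> W" if "e \<in># edges G" for e
  proof -
    have "set_uprod e \<subseteq> verts G" using assms(1) that by (simp add: finite_graph_def)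
    then show ?thesis using assms(2,3) by (auto simp: uprod.set_map inj_on_def subset_iff image_iff; blast)
  qed
  then have "filter_mset (\<lambda>e. set_uprod (map_uprod f e) \<subseteq> f ` W) (edges G) =
      filter_mset (\<lambda>e. set_uprod e \<subseteq> W) (edges G)"
    by (intro filter_mset_cong) auto
  then show ?thesis by (simp add: induce_def map_graph_def filter_mset_image_mset)
qed

lemma graph_iso_induce:
  assumes "graph_iso G H" "W \<subseteq> verts G"
  shows "\<exists>U \<subseteq> verts H. graph_iso (induce G W) (induce H U)"
proof -
  obtain f where f: "finite_graph G" "finite_graph H" "inj_on f (verts G)" "H = map_graph f G"
    using assms by (auto simp: graph_iso_def)
  have "induce H (f ` W) = map_graph f (induce G W)"
    using f assms by (simp add: induce_map_graph)
  moreover have "inj_on f (verts (induce G W))" using f assms by (auto intro: inj_on_subset)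
  moreover have "f ` W \<subseteq> verts H" using f assms by auto
  ultimately show ?thesis
    using f assms finite_graph_induce unfolding graph_iso_def by (metis finite_graph_map)
qed

lemma induced_subgraph_of_iso:
  assumes "induced_subgraph_of H G" "graph_iso H H'" "graph_iso G G'"
  shows "induced_subgraph_of H' G'"
proof -
  obtain W where W: "W \<subseteq> verts G" "graph_iso H (induce G W)"
    using assms by (auto simp: induced_subgraph_of_def)
  obtain U where "U \<subseteq> verts G'" "graph_iso (induce G W) (induce G' U)"
    using graph_iso_induce[OF assms(3) W(1)] by auto
  with W assms show ?thesis
    unfolding induced_subgraph_of_def by (meson graph_iso_sym graph_iso_trans)
qed

lemma induced_subgraph_of_trans:
  assumes "induced_subgraph_of K H" "induced_subgraph_of H G"
  shows "induced_subgraph_of K G"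
proof -
  obtain W where W: "W \<subseteq> verts G" "graph_iso H (induce G W)"
    using assms by (auto simp: induced_subgraph_of_def)
  obtain U where U: "U \<subseteq> verts H" "graph_iso K (induce H U)"
    using assms by (auto simp: induced_subgraph_of_def)
  obtain V where "V \<subseteq> W" "graph_iso (induce H U) (induce (induce G W) V)"
    using graph_iso_induce[OF W(2) U(1)] by auto
  then have "V \<subseteq> verts G" "graph_iso K (induce G V)"
    using W U graph_iso_trans by (auto simp: induce_induce)
  then show ?thesis unfolding induced_subgraph_of_def by blast
qed

lemma induced_subgraph_of_antisym:
  assumes "finite_graph G" "induced_subgraph_of H G" "induced_subgraph_of G H"
  shows "graph_iso H G"
proof -
  obtain W where W: "W \<subseteq> verts G" "graph_iso H (induce G W)"
    using assms by (auto simp: induced_subgraph_of_def)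
  obtain U where U: "U \<subseteq> verts H" "graph_iso G (induce H U)"
    using assms by (auto simp: induced_subgraph_of_def)
  have fin: "finite (verts G)" "finite (verts H)"
    using assms(1) W(2) by (auto simp: finite_graph_def graph_iso_def)
  have "card (verts G) \<le> card (verts H)"
    using graph_iso_card[OF U(2)] U(1) fin by (simp add: card_mono)
  then have "card W = card (verts G)"
    using graph_iso_card[OF W(2)] W(1) fin by (simp add: card_mono le_antisym)
  then have "W = verts G" using W(1) fin by (simp add: card_subset_eq)
  then show ?thesis using W(2) assms(1) by (simp add: induce_verts)
qed

lemma finite_graph_path: "finite_graph (path a)"
proof -
  have "finite {i. Suc i < a}" by (rule finite_subset[of _ "{..<a}"]) auto
  then show ?thesis by (auto simp: finite_graph_def path_def)
qed

lemma finite_graph_copies: "finite_graph G \<Longrightarrow> finite_graph (disjoint_copies n G)"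
  by (fastforce simp: finite_graph_def disjoint_copies_def set_mset_sum uprod.set_map)

lemma graph_iso_copies:
  assumes "graph_iso G H" shows "graph_iso (disjoint_copies n G) (disjoint_copies n H)"
proof -
  obtain f where f: "finite_graph G" "finite_graph H" "inj_on f (verts G)" "H = map_graph f G"
    using assms by (auto simp: graph_iso_def)
  define g where "g = (\<lambda>m. case prod_decode m of (k, v) \<Rightarrow> prod_encode (k, f v))"
  have g: "g (prod_encode (k, v)) = prod_encode (k, f v)" for k v by (simp add: g_def)
  have "inj_on g (verts (disjoint_copies n G))"
    using f(3) by (auto simp: disjoint_copies_def inj_on_def g)
  moreover have "image_mset h (\<Sum>k<n. M k) = (\<Sum>k<n. image_mset h (M k))"
    for h :: "nat uprod \<Rightarrow> nat uprod" and M :: "nat \<Rightarrow> nat uprod multiset"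
    by (induction n) auto
  then have "disjoint_copies n H = map_graph g (disjoint_copies n G)"
    by (simp add: f(4) disjoint_copies_def map_graph_def image_UN image_image g
        multiset.map_comp uprod.map_comp comp_def)
  ultimately show ?thesis
    using f finite_graph_copies unfolding graph_iso_def by blast
qed

text \<open>Every finite graph is isomorphic to one whose vertices are natural numbers.\<close>

quotient_type unlabelled_graph = "nat multigraph" / partial: graph_iso
proof (rule part_equivpI)
  have "finite_graph (Multigraph {} {#} :: nat multigraph)" by (simp add: finite_graph_def)
  then show "\<exists>x :: nat multigraph. graph_iso x x" using graph_iso_refl by blast
qed (auto intro: sympI transpI graph_iso_sym graph_iso_trans)

instantiation unlabelled_graph :: order
begin

lift_definition less_eq_unlabelled_graph :: "unlabelled_graph \<Rightarrow> unlabelled_graph \<Rightarrow> bool"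
  is induced_subgraph_of
  by (meson graph_iso_sym induced_subgraph_of_iso)

definition less_unlabelled_graph :: "unlabelled_graph \<Rightarrow> unlabelled_graph \<Rightarrow> bool" where
  "less_unlabelled_graph H G \<longleftrightarrow> H \<le> G \<and> \<not> G \<le> H"

instance
proof
  fix x y z :: unlabelled_graph
  show "x < y \<longleftrightarrow> x \<le> y \<and> \<not> y \<le> x" by (rule less_unlabelled_graph_def)
  show "x \<le> x"
    by transfer (auto simp: induced_subgraph_of_def graph_iso_def[of G G for G]
        intro!: exI[of _ "verts _"] simp: induce_verts graph_iso_refl)
  show "x \<le> z" if "x \<le> y" "y \<le> z"
    using that by transfer (rule induced_subgraph_of_trans)
  show "x = y" if "x \<le> y" "y \<le> x"
    using that by transfer (auto simp: graph_iso_def[of G G for G] intro: induced_subgraph_of_antisym)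
qed

end

class locally_finite_order = order +
  assumes finite_interval: "finite {a..b}"

instance unlabelled_graph :: locally_finite_order
proof
  fix a b :: unlabelled_graph
  let ?G = "rep_unlabelled_graph b"
  have G: "finite_graph ?G"
    using Quotient_rep_reflp[OF Quotient_unlabelled_graph, of b] by (simp add: graph_iso_def)
  have "c \<in> (\<lambda>W. abs_unlabelled_graph (induce ?G W)) ` Pow (verts ?G)" if "c \<le> b" for c
  proof -
    have "induced_subgraph_of (rep_unlabelled_graph c) ?G"
      using that by (simp add: less_eq_unlabelled_graph_def)
    then obtain W where W: "W \<subseteq> verts ?G" "graph_iso (rep_unlabelled_graph c) (induce ?G W)"
      by (auto simp: induced_subgraph_of_def)
    have "c = abs_unlabelled_graph (induce ?G W)"
      using Quotient_rel_abs[OF Quotient_unlabelled_graph W(2)]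
        Quotient_abs_rep[OF Quotient_unlabelled_graph, of c] by simp
    then show ?thesis using W(1) by blast
  qed
  then have "{a..b} \<subseteq> (\<lambda>W. abs_unlabelled_graph (induce ?G W)) ` Pow (verts ?G)" by auto
  moreover have "finite (Pow (verts ?G))" using G by (simp add: finite_graph_def)
  ultimately show "finite {a..b}" by (meson finite_imageI finite_subset)
qed

lift_definition path_graph :: "nat \<Rightarrow> unlabelled_graph" is path
  by (simp add: graph_iso_refl finite_graph_path)

lift_definition copies :: "nat \<Rightarrow> unlabelled_graph \<Rightarrow> unlabelled_graph" is disjoint_copies
  by (rule graph_iso_copies)

function moebius :: "'a::locally_finite_order \<Rightarrow> 'a \<Rightarrow> int" where
  "moebius a b =
     (if a = b then 1
      else if a < b then - (\<Sum>c\<in>{a..<b}. moebius a c)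
      else 0)"
  by auto
termination
proof (relation "measure (\<lambda>(a, b). card {a..b})")
  fix a b c :: 'a
  assume "a < b" "c \<in> {a..<b}"
  then have "{a..c} \<subset> {a..b}" by force
  then show "((a, c), (a, b)) \<in> measure (\<lambda>(a, b). card {a..b})"
    by (simp add: psubset_card_mono finite_interval)
qed simp

declare moebius.simps [simp del]

definition catalan :: "nat \<Rightarrow> rat" where
  "catalan n = 1 / of_nat (n + 1) * of_nat ((2 * n) choose n)"

end

theory Submission
  imports Defs
begin

text \<open>
  The graphs below a linear forest are linear forests, that is, multisets of component sizes ordered
  by bin packing. Let \<open>g c\<close> be the Moebius function from \<open>n\<close> isolated vertices to \<open>c\<close>, and group
  the forests \<open>A + 1\<^sup>s\<close> by their part \<open>A\<close> without isolated vertices. Since every packing into a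
  forest with \<open>l\<close> components can be filled up with isolated vertices to at least \<open>l\<close> components,
  induction shows that the partial sums of \<open>g (A + 1\<^sup>s)\<close> over \<open>s\<close> vanish as soon as \<open>A + 1\<^sup>s\<close> may have
  more than \<open>n\<close> components. Hence the sums \<open>w A\<close> over those \<open>s\<close> for which \<open>A + 1\<^sup>s\<close> has at most \<open>n\<close>
  components obey a recursion that involves only saturated pairs: the sum of \<open>w A\<close> over all \<open>A\<close>
  saturated in \<open>B\<close> is 1 if \<open>B\<close> is empty and 0 otherwise. If all components of \<open>B\<close> have at least
  three vertices, each of them shrinks by at most one vertex in a saturated pair, so the recursion
  is explicitly solvable. For two components of sizes \<open>a > b\<close> the
  solution is \<open>F\<^sub>b\<close> up to sign, and \<open>F\<^sub>a\<^sub>-\<^sub>2\<close> if \<open>a = b\<close>. For \<open>i\<close>, \<open>j\<close>, \<open>k\<close> components of sizes 5, 4, 3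
  it is, up to sign, the number of Motzkin paths with \<open>i + k\<close> up, \<open>j\<close> level and \<open>i\<close> down steps, which
  is the Catalan number \<open>C\<^sub>i\<close> for \<open>j = k = 0\<close> and 1 for \<open>i = j = 0\<close> or \<open>i = k = 0\<close>.
\<close>

section \<open>Packing\<close>

text \<open>A linear forest is represented by the multiset of its component sizes. Consecutive components
  inside a path are separated by at least one vertex, so a component with \<open>m\<close> vertices uses up
  \<open>m + 1\<close> of the \<open>x + 1\<close> units of \<open>P\<^sub>x\<close>: embedding linear forests is bin packing.\<close>

definition fits :: "nat multiset \<Rightarrow> nat \<Rightarrow> bool" where
  "fits K x \<longleftrightarrow> 0 \<notin># K \<and> sum_mset K + size K \<le> Suc x"

text \<open>\<open>P\<close> contains one load per bin, possibly empty. The multiset relator matches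
  loads with bins without ordering either of them.\<close>

definition packs :: "nat multiset \<Rightarrow> nat multiset \<Rightarrow> bool" where
  "packs N M \<longleftrightarrow> (\<exists>P. rel_mset fits P M \<and> N = \<Sum>\<^sub># P)"

abbreviation ones :: "nat \<Rightarrow> nat multiset" where
  "ones t \<equiv> replicate_mset t 1"

lemma fits_empty [simp]: "fits {#} x"
  by (simp add: fits_def)

lemma fits_single [simp]: "fits {#a#} x \<longleftrightarrow> 0 < a \<and> a \<le> x"
  by (auto simp: fits_def)

lemma fits_pair [simp]: "fits {#a, b#} x \<longleftrightarrow> 0 < a \<and> 0 < b \<and> a + b < x"
  by (auto simp: fits_def)

lemma packs_empty_right [simp]: "packs N {#} \<longleftrightarrow> N = {#}"
  by (simp add: packs_def)

lemma packs_add_mset: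
  "packs N (add_mset x M) \<longleftrightarrow> (\<exists>K N'. N = N' + K \<and> fits K x \<and> packs N' M)"
proof
  assume "packs N (add_mset x M)"
  then obtain P where P: "rel_mset fits P (add_mset x M)" "N = \<Sum>\<^sub># P"
    by (auto simp: packs_def)
  then obtain P1 K where "P = add_mset K P1" "fits K x" "rel_mset fits P1 M"
    using msed_rel_invR by metis
  with P show "\<exists>K N'. N = N' + K \<and> fits K x \<and> packs N' M"
    unfolding packs_def by (metis sum_mset.add_mset add.commute)
next
  assume "\<exists>K N'. N = N' + K \<and> fits K x \<and> packs N' M"
  then obtain K N' P where *: "N = N' + K" "fits K x" "rel_mset fits P M" "N' = \<Sum>\<^sub># P"
    by (auto simp: packs_def)
  then have "rel_mset fits (add_mset K P) (add_mset x M)" by (simp add: rel_mset_Plus)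
  with * show "packs N (add_mset x M)"
    unfolding packs_def by (metis sum_mset.add_mset add.commute)
qed

lemma packs_add_msetI: "packs N M \<Longrightarrow> fits K x \<Longrightarrow> packs (N + K) (add_mset x M)"
  by (auto simp: packs_add_mset)

lemma packs_add_msetE:
  assumes "packs N (add_mset x M)"
  obtains K N' where "N = N' + K" "fits K x" "packs N' M"
  using assms by (auto simp: packs_add_mset)

lemma packs_add_right: "packs N M \<Longrightarrow> packs N (add_mset x M)"
  using packs_add_msetI[of N M "{#}" x] by simp

lemma packs_empty_left [simp]: "packs {#} M"
  by (induction M) (auto intro: packs_add_right)

lemma packs_add_single: "packs N M \<Longrightarrow> 0 < a \<Longrightarrow> a \<le> x \<Longrightarrow> packs (add_mset a N) (add_mset x M)"
  using packs_add_msetI[of N M "{#a#}" x] by simp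

lemma packs_add_pair:
  "packs N M \<Longrightarrow> 0 < a \<Longrightarrow> 0 < b \<Longrightarrow> a + b < x \<Longrightarrow> packs (add_mset a (add_mset b N)) (add_mset x M)"
  using packs_add_msetI[of N M "{#a, b#}" x] by simp

lemma packs_pos: "packs N M \<Longrightarrow> 0 \<notin># N"
  by (induction M arbitrary: N) (auto simp: fits_def elim!: packs_add_msetE)

lemma packs_refl: "0 \<notin># M \<Longrightarrow> packs M M"
  by (induction M) (auto intro: packs_add_single)

lemma packs_plus: "packs N M \<Longrightarrow> packs N' M' \<Longrightarrow> packs (N + N') (M + M')"
proof (induction M arbitrary: N)
  case (add x M)
  then obtain K N1 where K: "N = N1 + K" "fits K x" "packs N1 M" by (auto elim: packs_add_msetE)
  then have "packs (N1 + N' + K) (add_mset x (M + M'))"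
    using add by (auto intro: packs_add_msetI)
  then show ?case by (simp add: K ac_simps)
qed auto

lemma rel_mset_le_packs: "rel_mset (\<lambda>a x. 0 < a \<and> a \<le> x) N M \<Longrightarrow> packs N M"
proof (induction M arbitrary: N)
  case (add x M)
  then obtain N1 a where "N = add_mset a N1" "0 < a \<and> a \<le> x"
      "rel_mset (\<lambda>a x. 0 < a \<and> a \<le> x) N1 M"
    using msed_rel_invR[OF add.prems] by blast
  then show ?case using add.IH by (simp add: packs_add_single)
qed auto

text \<open>The standard obstruction to a packing: a weight that no single bin can exceed is
  respected by the whole packing. Suitable choices of \<open>f\<close> rule out packings
  below.\<close>

lemma packs_superadditive:
  fixes f :: "nat \<Rightarrow> nat"
  assumes "\<And>K x. x \<in># M \<Longrightarrow> fits K x \<Longrightarrow> (\<Sum>a\<in>#K. f a) \<le> f x" and "packs N M"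
  shows "(\<Sum>a\<in>#N. f a) \<le> (\<Sum>x\<in>#M. f x)"
  using assms
proof (induction M arbitrary: N)
  case (add x M)
  then obtain K N' where "N = N' + K" "fits K x" "packs N' M" by (auto elim: packs_add_msetE)
  moreover have "(\<Sum>a\<in>#N'. f a) \<le> (\<Sum>x\<in>#M. f x)" using add calculation by auto
  ultimately show ?case using add.prems(1)[of x K] by simp
qed auto

lemma fits_le: "fits K x \<Longrightarrow> a \<in># K \<Longrightarrow> a \<le> x"
  by (auto simp: fits_def dest!: multi_member_split)

lemma packs_le:
  assumes "packs N M" "a \<in># N"
  shows "\<exists>x\<in>#M. a \<le> x"
  using assms
proof (induction M arbitrary: N)
  case (add x M)
  then obtain K N' where "N = N' + K" "fits K x" "packs N' M" by (auto elim: packs_add_msetE)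
  then show ?case using add by (auto dest: fits_le)
qed auto

lemma fits_subset: "fits K x \<Longrightarrow> K' \<subseteq># K \<Longrightarrow> fits K' x"
proof -
  assume "fits K x" "K' \<subseteq># K"
  moreover from this obtain L where "K = K' + L" by (auto simp: subset_mset.le_iff_add)
  ultimately show ?thesis by (auto simp: fits_def)
qed

lemma packs_remove: "packs (add_mset a N) M \<Longrightarrow> packs N M"
proof (induction M arbitrary: N)
  case (add x M)
  then obtain K N' where K: "add_mset a N = N' + K" "fits K x" "packs N' M"
    by (auto elim: packs_add_msetE)
  show ?case
  proof (cases "a \<in># K")
    case True
    then have "N = N' + (K - {#a#})" "fits (K - {#a#}) x"
      using K by (auto intro: fits_subset simp: union_single_eq_diff)
    then show ?thesis using K by (auto intro: packs_add_msetI)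
  next
    case False
    then have "a \<in># N'" using K(1) by (metis union_iff union_single_eq_member)
    then obtain N1 where "N' = add_mset a N1" by (auto dest: multi_member_split)
    then show ?thesis using K add.IH[of N1] by (auto intro: packs_add_msetI)
  qed
qed auto

lemma packs_subset: "packs (N + N') M \<Longrightarrow> packs N M"
  by (induction N') (auto dest: packs_remove)

lemma packs_ones_le: "packs (A + ones s) M \<Longrightarrow> s' \<le> s \<Longrightarrow> packs (A + ones s') M"
proof (induction s)
  case (Suc s)
  then show ?case using packs_remove[of 1 "A + ones s" M] by (cases "s' = Suc s") auto
qed auto

lemma packs_shrink: "packs (add_mset a N) M \<Longrightarrow> 0 < a' \<Longrightarrow> a' \<le> a \<Longrightarrow> packs (add_mset a' N) M"
proof (induction M arbitrary: N)
  case (add x M)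
  then obtain K N' where K: "add_mset a N = N' + K" "fits K x" "packs N' M"
    by (auto elim: packs_add_msetE)
  show ?case
  proof (cases "a \<in># K")
    case True
    then obtain K1 where K1: "K = add_mset a K1" by (auto dest: multi_member_split)
    then have "N = N' + K1" "fits (add_mset a' K1) x" using K add.prems by (auto simp: fits_def)
    then show ?thesis using packs_add_msetI[OF K(3), of "add_mset a' K1" x] by simp
  next
    case False
    then have "a \<in># N'" using K(1) by (metis union_iff union_single_eq_member)
    then obtain N1 where "N' = add_mset a N1" by (auto dest: multi_member_split)
    then show ?thesis using K add packs_add_msetI[of "add_mset a' N1" M K x] by auto
  qed
qed auto

lemma finite_fits: "finite {K. fits K x}"
proof -
  have "{K. fits K x} \<subseteq> mset ` {xs. set xs \<subseteq> {..x} \<and> length xs \<le> Suc x}"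
  proof
    fix K assume K: "K \<in> {K. fits K x}"
    obtain xs where xs: "K = mset xs" by (metis ex_mset)
    have "set xs \<subseteq> {..x}" using K xs fits_le by auto
    moreover have "length xs \<le> Suc x" using K xs by (auto simp: fits_def)
    ultimately show "K \<in> mset ` {xs. set xs \<subseteq> {..x} \<and> length xs \<le> Suc x}" using xs by auto
  qed
  then show ?thesis by (rule finite_subset) (simp add: finite_lists_length_le)
qed

lemma finite_packs: "finite {N. packs N M}"
proof (induction M)
  case (add x M)
  have "{N. packs N (add_mset x M)} = (\<lambda>(N', K). N' + K) ` ({N. packs N M} \<times> {K. fits K x})"
    by (auto simp: packs_add_mset image_iff)
  then show ?case using add finite_fits by simp
qed auto

text \<open>Two or more components in one bin cost at least one separating vertex, so only the
  undivided path keeps all \<open>x\<close> vertices.\<close>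

lemma fits_sum:
  assumes "fits K x" "0 < x"
  shows "K = {#x#} \<or> sum_mset K < x"
proof (cases "size K \<le> 1")
  case True
  then have "K = {#} \<or> size K = 1" by (simp add: le_Suc_eq)
  then consider "K = {#}" | a where "K = {#a#}" by (metis size_1_singleton_mset)
  then show ?thesis using assms by cases auto
next
  case False
  then show ?thesis using assms by (auto simp: fits_def)
qed

text \<open>Every proper packing loses vertices, which makes the vertex count the measure for the
  inductions on forests below.\<close>

lemma packs_sum: "packs N M \<Longrightarrow> 0 \<notin># M \<Longrightarrow> N = M \<or> sum_mset N < sum_mset M"
proof (induction M arbitrary: N)
  case (add x M)
  then obtain K N' where K: "N = N' + K" "fits K x" "packs N' M" by (auto elim: packs_add_msetE)
  then show ?case using add.IH[of N'] add.prems fits_sum[of K x] by auto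
qed auto

text \<open>Each empty bin takes one isolated vertex, and each other bin already contributes a
  component.\<close>

lemma packs_saturate:
  assumes "packs A M" "0 \<notin># M"
  shows "\<exists>s. packs (A + ones s) M \<and> size M \<le> size A + s"
  using assms
proof (induction M arbitrary: A)
  case (add x M)
  then obtain K N where K: "A = N + K" "fits K x" "packs N M" by (auto elim: packs_add_msetE)
  then obtain s where s: "packs (N + ones s) M" "size M \<le> size N + s" using add by auto
  show ?case
  proof (cases "K = {#}")
    case True
    then have "packs (A + ones (Suc s)) (add_mset x M)"
      using s K add.prems packs_add_single[OF s(1), of 1 x] by auto
    then show ?thesis using K s True by (intro exI[of _ "Suc s"]) auto
  next
    case False
    then obtain k where "size K = Suc k" by (cases "size K") auto
    moreover have "packs (A + ones s) (add_mset x M)"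
      using packs_add_msetI[OF s(1) K(2)] K by (simp add: ac_simps)
    ultimately show ?thesis using K s by (intro exI[of _ s]) auto
  qed
qed auto

text \<open>With fewer components than bins some bin is empty, and a bin of size at least 3 takes
  two isolated vertices.\<close>

lemma packs_saturate_strict:
  assumes "packs A M" "size A < size M" "\<forall>x\<in>#M. 3 \<le> x"
  shows "\<exists>s. packs (A + ones s) M \<and> size M < size A + s"
  using assms
proof (induction M arbitrary: A)
  case (add x M)
  then obtain K N where K: "A = N + K" "fits K x" "packs N M" by (auto elim: packs_add_msetE)
  show ?case
  proof (cases "K = {#}")
    case True
    have "0 \<notin># M" using add.prems by auto
    then obtain s where s: "packs (N + ones s) M" "size M \<le> size N + s"
      using packs_saturate[OF K(3)] by blast
    then have "packs (A + ones (Suc (Suc s))) (add_mset x M)"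
      using s K add.prems True packs_add_pair[OF s(1), of 1 1 x] by auto
    then show ?thesis using K s True by (intro exI[of _ "Suc (Suc s)"]) auto
  next
    case False
    then obtain k where *: "size K = Suc k" by (cases "size K") auto
    then have "size N < size M" using add.prems K by auto
    then obtain s where s: "packs (N + ones s) M" "size M < size N + s" using add K by auto
    moreover have "packs (A + ones s) (add_mset x M)"
      using packs_add_msetI[OF s(1) K(2)] K by (simp add: ac_simps)
    ultimately show ?thesis using K s * by (intro exI[of _ s]) auto
  qed
qed auto

lemma fits_1: "fits K 1 \<longleftrightarrow> K = {#} \<or> K = {#1#}"
proof
  assume "fits K 1"
  then have "K = {#1#} \<or> (\<forall>a\<in>#K. a = 0) \<and> 0 \<notin># K"
    using fits_sum[of K 1] by (auto simp: fits_def)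
  then show "K = {#} \<or> K = {#1#}" by (metis multiset_nonemptyE)
qed auto

lemma fits_2: "fits K 2 \<longleftrightarrow> K = {#} \<or> K = {#1#} \<or> K = {#2#}"
proof
  assume K: "fits K 2"
  show "K = {#} \<or> K = {#1#} \<or> K = {#2#}"
  proof (cases "K = {#2#}")
    case False
    then have "sum_mset K < 2" using K fits_sum[of K 2] by auto
    moreover have "size K \<le> sum_mset K"
      using K unfolding fits_def by (induction K) auto
    ultimately have "fits K 1" using K by (auto simp: fits_def)
    then show ?thesis using fits_1 by blast
  qed auto
qed auto

text \<open>A bin of size 1 holds nothing or one isolated vertex, so \<open>t\<close> such bins
  absorb isolated vertices one for one; truncated subtraction covers \<open>s < t\<close>. This
  removes isolated vertices from the target.\<close>

lemma packs_ones_right: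
  assumes "1 \<notin># A"
  shows "packs (A + ones s) (B + ones t) \<longleftrightarrow> packs (A + ones (s - t)) B"
proof (induction t arbitrary: s)
  case (Suc t)
  have "packs (A + ones s) (add_mset 1 (B + ones t)) \<longleftrightarrow> packs (A + ones (s - 1)) (B + ones t)"
  proof
    assume "packs (A + ones s) (add_mset 1 (B + ones t))"
    then obtain K N where K: "A + ones s = N + K" "fits K 1" "packs N (B + ones t)"
      by (auto elim: packs_add_msetE)
    then consider "K = {#}" | "K = {#1#}" using fits_1 by blast
    then show "packs (A + ones (s - 1)) (B + ones t)"
    proof cases
      case 1
      then show ?thesis using K packs_ones_le[of A s "B + ones t" "s - 1"] by simp
    next
      case 2
      then have "A + ones s = add_mset 1 N" using K by simp
      moreover from this have "s \<noteq> 0" using assms by (cases s) auto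
      ultimately have "N = A + ones (s - 1)" by (cases s) auto
      then show ?thesis using K by simp
    qed
  next
    assume *: "packs (A + ones (s - 1)) (B + ones t)"
    show "packs (A + ones s) (add_mset 1 (B + ones t))"
    proof (cases s)
      case 0
      then show ?thesis using * packs_add_right by simp
    next
      case (Suc s')
      then show ?thesis using packs_add_single[OF *, of 1 1] by simp
    qed
  qed
  then show ?case using Suc.IH[of "s - 1"] by simp
qed auto

section \<open>The recursion over saturated packings\<close>

text \<open>A saturated \<open>A\<close> admits no packing into \<open>B\<close> that leaves room to raise the number of components
  above that of \<open>B\<close> by adding isolated vertices.\<close>

definition saturated :: "nat multiset \<Rightarrow> nat multiset \<Rightarrow> bool" where
  "saturated A B \<longleftrightarrow> 1 \<notin># A \<and> packs A B \<and> \<not> packs (A + ones (Suc (size B) - size A)) B"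

text \<open>If \<open>A\<close> had more components than \<open>B\<close>, the truncated difference
  in the definition would be 0 and its two packing conditions would contradict each other.\<close>

lemma saturated_size: "saturated A B \<Longrightarrow> size A \<le> size B"
  by (rule ccontr) (auto simp: saturated_def)

lemma finite_saturated: "finite {A. saturated A B}"
  by (rule finite_subset[OF _ finite_packs[of B]]) (auto simp: saturated_def)

text \<open>One more isolated vertex would exceed the vertex count of \<open>B\<close>, against
  \<open>packs_sum\<close>.\<close>

lemma saturated_refl: "0 \<notin># B \<Longrightarrow> 1 \<notin># B \<Longrightarrow> saturated B B"
  using packs_sum[of "B + {#1#}" B] by (auto simp: saturated_def packs_refl)

definition room :: "nat multiset \<Rightarrow> nat multiset \<Rightarrow> nat" where
  "room A b = Max {s. packs (A + ones s) b}"

lemma finite_room: "finite {s. packs (A + ones s) b}"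
proof -
  have "inj_on (\<lambda>s. A + ones s) {s. packs (A + ones s) b}"
    by (auto simp: inj_on_def replicate_mset_eq_iff)
  moreover have "(\<lambda>s. A + ones s) ` {s. packs (A + ones s) b} \<subseteq> {N. packs N b}" by auto
  ultimately show ?thesis using finite_packs[of b] finite_subset finite_imageD by metis
qed

lemma packs_iff_le_room:
  assumes "packs A b"
  shows "packs (A + ones s) b \<longleftrightarrow> s \<le> room A b"
proof
  show "packs (A + ones s) b \<Longrightarrow> s \<le> room A b"
    unfolding room_def by (rule Max_ge[OF finite_room]) simp
  have "0 \<in> {s. packs (A + ones s) b}" using assms by simp
  then have "room A b \<in> {s. packs (A + ones s) b}"
    unfolding room_def using Max_in[OF finite_room] by blast
  then show "s \<le> room A b \<Longrightarrow> packs (A + ones s) b" using packs_ones_le by blast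
qed

lemma room_ge:
  assumes "packs A b" "0 \<notin># b"
  shows "size b \<le> size A + room A b"
proof -
  obtain s where "packs (A + ones s) b" "size b \<le> size A + s"
    using packs_saturate[OF assms] by blast
  then show ?thesis using packs_iff_le_room[OF assms(1), of s] by simp
qed

lemma filter_ne_plus_ones: "A = filter_mset (\<lambda>a. a \<noteq> 1) A + ones (count A 1)"
  by (rule multiset_eqI) auto

text \<open>A forest is determined by its part without isolated vertices and the number of its
  isolated vertices. For a fixed part the admissible numbers are those up to
  \<open>room\<close>.\<close>

lemma sum_packs_by_ones:
  fixes g :: "nat multiset \<Rightarrow> int"
  shows "(\<Sum>c | packs c b. g c) =
    (\<Sum>A | 1 \<notin># A \<and> packs A b. \<Sum>s\<le>room A b. g (A + ones s))"
proof -
  let ?S = "SIGMA A:{A. 1 \<notin># A \<and> packs A b}. {..room A b}"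
  have "bij_betw (\<lambda>(A, s). A + ones s) ?S {c. packs c b}"
  proof (rule bij_betw_byWitness[where f' = "\<lambda>c. (filter_mset (\<lambda>a. a \<noteq> 1) c, count c 1)"])
    show "(\<lambda>(A, s). A + ones s) ` ?S \<subseteq> {c. packs c b}"
      using packs_iff_le_room by auto
    have *: "packs (filter_mset (\<lambda>a. a \<noteq> 1) c) b" if "packs c b" for c
      using that packs_subset filter_ne_plus_ones by metis
    have "count c 1 \<le> room (filter_mset (\<lambda>a. a \<noteq> 1) c) b" if "packs c b" for c
      using that packs_iff_le_room[OF *[OF that], of "count c 1"] filter_ne_plus_ones[of c] by simp
    then show "(\<lambda>c. (filter_mset (\<lambda>a. a \<noteq> 1) c, count c 1)) ` {c. packs c b} \<subseteq> ?S"
      using * by auto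
    show "\<forall>c\<in>{c. packs c b}. (case (filter_mset (\<lambda>a. a \<noteq> 1) c, count c 1) of (A, s) \<Rightarrow> A + ones s) = c"
      using filter_ne_plus_ones[symmetric] by simp
    show "\<forall>x\<in>?S. (\<lambda>c. (filter_mset (\<lambda>a. a \<noteq> 1) c, count c 1)) (case x of (A, s) \<Rightarrow> A + ones s) = x"
    proof
      fix x assume x: "x \<in> ?S"
      obtain A s where As: "x = (A, s)" by (cases x)
      then have "count A 1 = 0" using x by (auto simp: count_eq_zero_iff)
      then show "(\<lambda>c. (filter_mset (\<lambda>a. a \<noteq> 1) c, count c 1)) (case x of (A, s) \<Rightarrow> A + ones s) = x"
        unfolding As by (auto intro!: multiset_eqI)
    qed
  qed
  then have "(\<Sum>c | packs c b. g c) = (\<Sum>(A, s)\<in>?S. g (A + ones s))"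
    by (subst sum.reindex_bij_betw[symmetric]) (auto simp: case_prod_unfold)
  also have "\<dots> = (\<Sum>A | 1 \<notin># A \<and> packs A b. \<Sum>s\<le>room A b. g (A + ones s))"
    by (rule sum.Sigma[symmetric])
      (auto intro: finite_subset[OF _ finite_packs[of b]])
  finally show ?thesis .
qed

lemma room_plus_ones:
  assumes "1 \<notin># A" "packs A B"
  shows "room A (B + ones t) = room A B + t"
proof (rule le_antisym)
  have *: "packs A (B + ones t)" using packs_plus[of A B "{#}" "ones t"] assms by simp
  have "packs (A + ones s) (B + ones t) \<longleftrightarrow> s \<le> room A B + t" for s
    using packs_ones_right[OF assms(1)] packs_iff_le_room[OF assms(2)] by auto
  then show "room A (B + ones t) \<le> room A B + t" "room A B + t \<le> room A (B + ones t)"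
    using packs_iff_le_room[OF *] by auto
qed

text \<open>\<open>room_ge\<close> bounds the left-hand sum from below in any case; saturation is
  equality.\<close>

lemma saturated_iff_room:
  assumes "1 \<notin># A" "packs A B" "0 \<notin># B"
  shows "saturated A B \<longleftrightarrow> size A + room A B = size B"
  using assms room_ge[OF assms(2,3)] packs_iff_le_room[OF assms(2)] by (auto simp: saturated_def)

text \<open>\<open>g\<close> plays the role of the Moebius function from \<open>n\<close> isolated vertices.\<close>

locale forest_moebius =
  fixes g :: "nat multiset \<Rightarrow> int" and n :: nat
  assumes g_sum: "0 \<notin># b \<Longrightarrow> (\<Sum>c | packs c b. g c) = (if b = ones n then 1 else 0)"
begin

definition cumul :: "nat multiset \<Rightarrow> nat \<Rightarrow> int" where
  "cumul A t = (\<Sum>s\<le>t. g (A + ones s))"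

lemma cumul_sum:
  assumes "0 \<notin># b"
  shows "(\<Sum>A | 1 \<notin># A \<and> packs A b. cumul A (room A b)) = (if b = ones n then 1 else 0)"
  using g_sum[OF assms] sum_packs_by_ones[of g b] by (simp add: cumul_def)

text \<open>The target \<open>A + ones t\<close> has more than \<open>n\<close> components, so its
  sum in \<open>cumul_sum\<close> is 0. Every other \<open>A'\<close> in that sum has fewer vertices
  than \<open>A\<close> and extends to at least as many components as the target, so its term
  vanishes by induction. The term of \<open>A\<close> itself is \<open>cumul A t\<close>.\<close>

lemma cumul_eq_0:
  assumes "0 \<notin># A" "1 \<notin># A" "n < size A + t"
  shows "cumul A t = 0"
  using assms
proof (induction "sum_mset A" arbitrary: A t rule: less_induct)
  case less
  let ?b = "A + ones t"
  have "?b \<noteq> ones n"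
  proof
    assume *: "A + ones t = ones n"
    then have "size A + t = n" by (metis size_union size_replicate_mset)
    then show False using less.prems by simp
  qed
  moreover have b: "0 \<notin># ?b" using less.prems by simp
  ultimately have "(\<Sum>A' | 1 \<notin># A' \<and> packs A' ?b. cumul A' (room A' ?b)) = 0"
    using cumul_sum by simp
  moreover have AA: "packs A A" using packs_refl less.prems by simp
  moreover have Ab: "packs A ?b" using AA packs_plus[of A A "{#}" "ones t"] by simp
  moreover have "cumul A' (room A' ?b) = 0" if "1 \<notin># A'" "packs A' ?b" "A' \<noteq> A" for A'
  proof -
    have "packs A' A" using packs_ones_right[OF that(1), of 0 A t] that(2) by simp
    then have "sum_mset A' < sum_mset A" using packs_sum that less.prems by blast
    moreover have "n < size A' + room A' ?b" using room_ge[OF that(2) b] less.prems by simp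
    ultimately show ?thesis using less.hyps that packs_pos by blast
  qed
  moreover have "room A A = 0"
  proof -
    have "saturated A A" using saturated_refl less.prems by simp
    then show ?thesis using saturated_iff_room AA less.prems by simp
  qed
  then have "room A ?b = t" using room_plus_ones AA less.prems by simp
  moreover have "(\<Sum>A' | 1 \<notin># A' \<and> packs A' ?b. cumul A' (room A' ?b)) =
      (\<Sum>A' \<in> {A}. cumul A' (room A' ?b))"
    using calculation less.prems
    by (intro sum.mono_neutral_right finite_subset[OF _ finite_packs[of ?b]]) auto
  ultimately show ?case by simp
qed

text \<open>The weight \<open>w\<close> of the overview. If \<open>size A = n\<close>, the sum has a
  single term and equals \<open>g A\<close>, which is how \<open>g\<close> is recovered in the
  end.\<close>

definition solution :: "nat multiset \<Rightarrow> int" where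
  "solution A = cumul A (n - size A)"

text \<open>The target is \<open>B\<close> padded with isolated vertices to exactly \<open>n\<close>
  components. An unsaturated \<open>A\<close> can be extended beyond \<open>n\<close> components
  there, so \<open>cumul_eq_0\<close> removes it; a saturated one can be extended to exactly
  \<open>n\<close>, which gives \<open>solution A\<close>.\<close>

lemma solution_sum:
  assumes "0 \<notin># B" "1 \<notin># B" "size B \<le> n"
  shows "(\<Sum>A | saturated A B. solution A) = (if B = {#} then 1 else 0)"
proof -
  let ?b = "B + ones (n - size B)"
  have b: "0 \<notin># ?b" using assms by simp
  have pb: "packs A ?b \<longleftrightarrow> packs A B" if "1 \<notin># A" for A
    using packs_ones_right[OF that, of 0 B] by simp
  have "(?b = ones n) = (B = {#})"
  proof
    assume "?b = ones n"
    then have "set_mset B \<subseteq> {1}" by (metis set_mset_replicate_mset_subset set_mset_union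
          empty_subsetI le_sup_iff order_refl)
    then show "B = {#}" using assms by (metis multiset_nonemptyE singletonD subsetD)
  qed simp
  then have "(if B = {#} then 1 else 0) = (\<Sum>A | 1 \<notin># A \<and> packs A ?b. cumul A (room A ?b))"
    using cumul_sum[OF b] by simp
  also have "\<dots> = (\<Sum>A | saturated A B. cumul A (room A ?b))"
  proof (rule sum.mono_neutral_right)
    show "finite {A. 1 \<notin># A \<and> packs A ?b}"
      by (rule finite_subset[OF _ finite_packs[of ?b]]) auto
    show "{A. saturated A B} \<subseteq> {A. 1 \<notin># A \<and> packs A ?b}" using pb by (auto simp: saturated_def)
    show "\<forall>A\<in>{A. 1 \<notin># A \<and> packs A ?b} - {A. saturated A B}. cumul A (room A ?b) = 0"
    proof
      fix A assume "A \<in> {A. 1 \<notin># A \<and> packs A ?b} - {A. saturated A B}"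
      then have A: "1 \<notin># A" "packs A B" "\<not> saturated A B" using pb by auto
      then have "size B < size A + room A B"
        using saturated_iff_room room_ge assms by (metis le_neq_implies_less)
      then have "n < size A + room A ?b" using room_plus_ones A assms by simp
      then show "cumul A (room A ?b) = 0" using cumul_eq_0 A packs_pos by blast
    qed
  qed
  also have "\<dots> = (\<Sum>A | saturated A B. solution A)"
  proof (rule sum.cong)
    fix A assume "A \<in> {A. saturated A B}"
    then have A: "1 \<notin># A" "packs A B" "saturated A B" by (auto simp: saturated_def)
    then have "room A ?b = n - size A"
      using saturated_iff_room room_plus_ones assms by fastforce
    then show "cumul A (room A ?b) = solution A" by (simp add: solution_def)
  qed simp
  finally show ?thesis by simp
qed

text \<open>The system is unitriangular: \<open>B\<close> is saturated in itself, and every other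
  \<open>A\<close> saturated in \<open>B\<close> has fewer vertices. A closed family therefore
  admits only one solution.\<close>

lemma solution_unique:
  fixes w :: "nat multiset \<Rightarrow> int"
  assumes family: "\<And>B. B \<in> \<B> \<Longrightarrow> 0 \<notin># B \<and> 1 \<notin># B \<and> size B \<le> n"
    and closed: "\<And>A B. B \<in> \<B> \<Longrightarrow> saturated A B \<Longrightarrow> A \<in> \<B>"
    and w: "\<And>B. B \<in> \<B> \<Longrightarrow> (\<Sum>A | saturated A B. w A) = (if B = {#} then 1 else 0)"
    and "B \<in> \<B>"
  shows "solution B = w B"
  using \<open>B \<in> \<B>\<close>
proof (induction "sum_mset B" arbitrary: B rule: less_induct)
  case less
  have B: "0 \<notin># B" "1 \<notin># B" "size B \<le> n" using family less.prems by auto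
  have split: "(\<Sum>A | saturated A B. f A) = f B + (\<Sum>A\<in>{A. saturated A B} - {B}. f A)"
    for f :: "nat multiset \<Rightarrow> int"
    using saturated_refl B finite_saturated by (subst sum.remove[of _ B]) auto
  have "solution A = w A" if "A \<in> {A. saturated A B} - {B}" for A
  proof -
    have "packs A B" "A \<noteq> B" using that by (auto simp: saturated_def)
    then have "sum_mset A < sum_mset B" using packs_sum B by blast
    then show ?thesis using less that closed by blast
  qed
  then have "(\<Sum>A\<in>{A. saturated A B} - {B}. solution A) = (\<Sum>A\<in>{A. saturated A B} - {B}. w A)"
    by (intro sum.cong) auto
  then show ?case
    using split[of solution] split[of w] w[OF less.prems] solution_sum[OF B] by simp
qed

lemma g_unique:
  fixes w :: "nat multiset \<Rightarrow> int"
  assumes "\<And>B. B \<in> \<B> \<Longrightarrow> 0 \<notin># B \<and> 1 \<notin># B \<and> size B \<le> n"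
    and "\<And>A B. B \<in> \<B> \<Longrightarrow> saturated A B \<Longrightarrow> A \<in> \<B>"
    and "\<And>B. B \<in> \<B> \<Longrightarrow> (\<Sum>A | saturated A B. w A) = (if B = {#} then 1 else 0)"
    and "B \<in> \<B>" "size B = n"
  shows "g B = w B"
  using solution_unique[of \<B> w B] assms by (simp add: solution_def cumul_def)

end

section \<open>Cancellation for targets with a component of size 2\<close>

text \<open>As \<open>A\<close> contains no 2, the bin of size 2 holds at most an isolated vertex.
  Giving up that vertex, or any other one if the bin is empty, makes the bin free for the 2.\<close>

lemma packs_two_iff:
  assumes "1 \<notin># A" "2 \<notin># A" "2 \<in># B"
  shows "packs (add_mset 2 A + ones s) B \<longleftrightarrow> packs (A + ones (Suc s)) B"
proof
  assume "packs (add_mset 2 A + ones s) B"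
  then show "packs (A + ones (Suc s)) B"
    using packs_shrink[of 2 "A + ones s" B 1] by simp
next
  assume *: "packs (A + ones (Suc s)) B"
  obtain B' where B: "B = add_mset 2 B'" using multi_member_split[OF assms(3)] by blast
  then obtain K N where K: "A + ones (Suc s) = N + K" "fits K 2" "packs N B'"
    using * by (auto elim: packs_add_msetE)
  have "2 \<notin># A + ones (Suc s)" using assms by simp
  then have "2 \<notin># K" using K by (metis union_iff)
  then consider "K = {#}" | "K = {#1#}" using K(2) fits_2 by (metis union_single_eq_member)
  then have "packs (A + ones s) B'"
  proof cases
    case 1
    then show ?thesis using K packs_remove[of 1 "A + ones s" B'] by simp
  next
    case 2
    then show ?thesis using K by simp
  qed
  then show "packs (add_mset 2 A + ones s) B"
    using packs_add_single[of "A + ones s" B' 2 2] B by simp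
qed

text \<open>Without components of size 1 or 2 in \<open>A\<close>, the bin of size 2 stays
  empty.\<close>

lemma packs_add_one:
  assumes "1 \<notin># A" "2 \<notin># A" "2 \<in># B" "packs A B"
  shows "packs (add_mset 1 A) B"
proof -
  obtain B' where B: "B = add_mset 2 B'" using multi_member_split[OF assms(3)] by blast
  then obtain K N where K: "A = N + K" "fits K 2" "packs N B'"
    using assms by (auto elim: packs_add_msetE)
  then have "K = {#}" using fits_2 assms by (metis union_iff union_single_eq_member)
  then show ?thesis using packs_add_single[OF K(3), of 1 2] K B by simp
qed

text \<open>While \<open>A\<close> has fewer components than \<open>B\<close>, the 2 trades for an
  isolated vertex by \<open>packs_two_iff\<close>. Otherwise neither side is saturated: the 2 would
  be one component too many, and \<open>A\<close> alone leaves the bin of size 2 empty.\<close>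

lemma saturated_add_two_iff:
  assumes "1 \<notin># A" "2 \<notin># A" "2 \<in># B"
  shows "saturated (add_mset 2 A) B \<longleftrightarrow> saturated A B"
proof (cases "size A < size B")
  case True
  have "packs (add_mset 2 A) B \<longleftrightarrow> packs A B"
    using packs_two_iff[OF assms, of 0] packs_add_one[OF assms] packs_remove[of 1 A B] by auto
  moreover have "packs (add_mset 2 A + ones (Suc (size B) - size (add_mset 2 A))) B \<longleftrightarrow>
      packs (A + ones (Suc (size B) - size A)) B"
    using True packs_two_iff[OF assms, of "size B - size A"] by (simp add: Suc_diff_le)
  ultimately show ?thesis using assms by (auto simp: saturated_def)
next
  case False
  moreover have "\<not> saturated A B"
  proof
    assume "saturated A B"
    moreover from this have "size A = size B" using False saturated_size by fastforce
    ultimately show False using packs_add_one[OF assms] by (simp add: saturated_def)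
  qed
  ultimately show ?thesis using saturated_size[of "add_mset 2 A" B] by auto
qed

text \<open>A sign-reversing pairing of \<open>A\<close> with \<open>add_mset 2 A\<close>, for
  \<open>A\<close> without a 2. Both explicit weights below satisfy the hypotheses, so targets
  containing a 2 need no further work.\<close>

lemma sum_saturated_two:
  fixes w :: "nat multiset \<Rightarrow> int"
  assumes "2 \<in># B"
    and one: "\<And>A. saturated (add_mset 2 A) B \<Longrightarrow> 2 \<notin># A \<Longrightarrow> w (add_mset 2 A) = - w A"
    and many: "\<And>A. saturated A B \<Longrightarrow> 2 \<le> count A 2 \<Longrightarrow> w A = 0"
  shows "(\<Sum>A | saturated A B. w A) = 0"
proof -
  let ?S0 = "{A. saturated A B \<and> 2 \<notin># A}"
  have inj: "inj_on (add_mset 2) ?S0" by (auto simp: inj_on_def)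
  have fin: "finite ?S0" by (rule finite_subset[OF _ finite_saturated[of B]]) auto
  have saturated_one: "1 \<notin># A" if "saturated A B" for A using that by (simp add: saturated_def)
  have "(\<Sum>A | saturated A B. w A) = (\<Sum>A \<in> ?S0 \<union> add_mset 2 ` ?S0. w A)"
  proof (rule sum.mono_neutral_right[OF finite_saturated])
    show "?S0 \<union> add_mset 2 ` ?S0 \<subseteq> {A. saturated A B}"
      using saturated_add_two_iff[OF saturated_one _ assms(1)] by auto
    show "\<forall>A\<in>{A. saturated A B} - (?S0 \<union> add_mset 2 ` ?S0). w A = 0"
    proof
      fix A assume A: "A \<in> {A. saturated A B} - (?S0 \<union> add_mset 2 ` ?S0)"
      then have "2 \<in># A" by auto
      then obtain A' where A': "A = add_mset 2 A'" by (metis multi_member_split)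
      have "2 \<in># A'"
      proof (rule ccontr)
        assume "2 \<notin># A'"
        moreover from this have "saturated A' B"
          using saturated_add_two_iff[of A' B] saturated_one[of A] assms(1) A A' by auto
        ultimately show False using A A' by blast
      qed
      then have "2 \<le> count A 2" using A' by (simp add: Suc_le_eq)
      then show "w A = 0" using many A by blast
    qed
  qed
  also have "\<dots> = (\<Sum>A\<in>?S0. w A) + (\<Sum>A\<in>add_mset 2 ` ?S0. w A)"
    using fin by (intro sum.union_disjoint) auto
  also have "(\<Sum>A\<in>add_mset 2 ` ?S0. w A) = (\<Sum>A\<in>?S0. - w A)"
    unfolding sum.reindex[OF inj] comp_def
    using one saturated_add_two_iff[OF saturated_one _ assms(1)] by (intro sum.cong) auto
  finally show ?thesis by (simp add: sum_negf)
qed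

section \<open>Saturated packings into components of size at least 3\<close>

lemma saturated_imp_size_eq:
  assumes "saturated A B" "\<forall>x\<in>#B. 3 \<le> x"
  shows "size A = size B"
proof (rule ccontr)
  assume "size A \<noteq> size B"
  then have "size A < size B" using saturated_size assms by (simp add: le_neq_implies_less)
  then obtain s where "packs (A + ones s) B" "size B < size A + s"
    using packs_saturate_strict[of A B] assms by (auto simp: saturated_def)
  then show False using assms packs_ones_le[of A s B] by (simp add: saturated_def)
qed

abbreviation near :: "nat \<Rightarrow> nat \<Rightarrow> bool" where
  "near a x \<equiv> 0 < a \<and> (a = x \<or> Suc a = x)"

text \<open>An empty bin would accept an isolated vertex, so counting leaves exactly one component
  per bin. A component shorter than its bin by two or more would leave space for an isolated vertex
  next to it.\<close>

lemma packs_tight: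
  assumes "packs A B" "size A = size B" "\<not> packs (add_mset 1 A) B" "0 \<notin># B"
  shows "rel_mset near A B"
  using assms
proof (induction B arbitrary: A)
  case (add x B)
  then obtain K N where K: "A = N + K" "fits K x" "packs N B" by (auto elim: packs_add_msetE)
  have x: "1 \<le> x" using add.prems by (cases x) auto
  have N1: "\<not> packs (add_mset 1 N) B"
    using packs_add_msetI[OF _ K(2), of "add_mset 1 N" B] add.prems K by auto
  have "K \<noteq> {#}"
    using packs_add_single[OF K(3), of 1 x] add.prems(3) K(1) x by auto
  moreover have "\<not> size N < size B"
  proof
    assume *: "size N < size B"
    obtain s where "packs (N + ones s) B" "size B \<le> size N + s"
      using packs_saturate[OF K(3)] add.prems by auto
    then have "packs (N + ones 1) B" using packs_ones_le[of N s B 1] * by auto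
    then show False using N1 by simp
  qed
  ultimately have sz: "size N = size B" "size K = 1"
    using add.prems(2) K(1) by (cases "size K"; auto)+
  then obtain a where a: "K = {#a#}" by (metis size_1_singleton_mset)
  have "\<not> Suc a < x"
    using packs_add_pair[OF K(3), of a 1 x] add.prems(3) K a by (auto simp: add_mset_commute)
  then have "0 < a \<and> (a = x \<or> Suc a = x)" using K(2) a by auto
  moreover have "rel_mset near N B"
    using add.IH[OF K(3) sz(1) N1] add.prems by auto
  ultimately show ?case using K(1) a by (simp add: rel_mset_Plus)
qed auto

text \<open>The numbers of components agree, so saturation only forbids one additional isolated
  vertex. Bins of size at least 3 shrink to size at least 2, which keeps 1 out of
  \<open>A\<close>.\<close>

lemma saturated_iff:
  assumes "\<forall>x\<in>#B. 3 \<le> x"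
  shows "saturated A B \<longleftrightarrow>
    rel_mset near A B \<and> \<not> packs (add_mset 1 A) B"
proof
  assume A: "saturated A B"
  then have "size A = size B" using saturated_imp_size_eq assms by blast
  moreover from this have "packs A B" "\<not> packs (add_mset 1 A) B" using A by (auto simp: saturated_def)
  moreover have "0 \<notin># B" using assms by auto
  ultimately show "rel_mset near A B \<and> \<not> packs (add_mset 1 A) B" using packs_tight[of A B] by simp
next
  assume A: "rel_mset near A B \<and> \<not> packs (add_mset 1 A) B"
  then have R: "rel_mset near A B" by simp
  have "rel_mset (\<lambda>a x. 0 < a \<and> a \<le> x) A B" by (rule multiset.rel_mono_strong[OF R]) auto
  then have "packs A B" by (rule rel_mset_le_packs)
  moreover have "size A = size B" using A rel_mset_size by blast
  moreover have "1 \<notin># A"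
  proof
    assume "1 \<in># A"
    then obtain A' where "A = add_mset 1 A'" by (metis multi_member_split)
    then obtain B' b where "B = add_mset b B'" "near 1 b" using msed_rel_invL[of near 1 A' B] R by blast
    then show False using assms by auto
  qed
  ultimately show "saturated A B" using A by (simp add: saturated_def)
qed

section \<open>At most two components\<close>

lemma packs_single: "packs N {#y#} \<longleftrightarrow> fits N y"
  by (simp add: packs_add_mset)

lemma packs_pair: "packs N {#y, z#} \<longleftrightarrow> (\<exists>K L. N = K + L \<and> fits K y \<and> fits L z)"
  by (simp add: packs_add_mset) (metis add.commute)

lemma sum_mset_Suc: "(\<Sum>a\<in>#A. Suc a) = sum_mset A + size A"
  by (induction A) auto

lemma packs_weight: "packs N M \<Longrightarrow> (\<Sum>a\<in>#N. Suc a) \<le> (\<Sum>x\<in>#M. Suc x)"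
  by (rule packs_superadditive) (auto simp: sum_mset_Suc fits_def)

lemma sum_mset_Suc_eq_1:
  assumes "0 \<notin># K"
  shows "(\<Sum>a\<in>#K. Suc a) \<noteq> 1"
  using assms by (cases K) auto

text \<open>With weights \<open>Suc a\<close> the components use up both bins exactly. Next to
  \<open>y - 1\<close> one unit would be left in the bin \<open>y\<close>, and also in the bin
  \<open>z\<close> if \<open>y = z\<close>, but no component has weight 1. For larger
  \<open>y\<close> the bin \<open>z\<close> is too small.\<close>

lemma not_packs_near_pair:
  assumes "z \<le> y" "3 \<le> z" "y \<noteq> Suc z"
  shows "\<not> packs {#1, y - 1, z - 1#} {#y, z#}"
proof
  let ?S = "\<lambda>K. \<Sum>a\<in>#K. Suc a"
  assume "packs {#1, y - 1, z - 1#} {#y, z#}"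
  then obtain K L where N: "{#1, y - 1, z - 1#} = K + L" and KL: "fits K y" "fits L z"
    by (auto simp: packs_pair)
  have "?S (K + L) = Suc y + Suc z" using assms unfolding N[symmetric] by simp
  moreover have "?S K \<le> Suc y" "?S L \<le> Suc z" using KL by (auto simp: sum_mset_Suc fits_def)
  ultimately have eq: "?S K = Suc y" "?S L = Suc z" by auto
  have "y - 1 \<in># K + L" unfolding N[symmetric] by simp
  then consider K' where "K = add_mset (y - 1) K'" | L' where "L = add_mset (y - 1) L'"
    by (metis multi_member_split union_iff)
  then show False
  proof cases
    case 1
    then have "?S K' = 1" using eq assms by simp
    then show False using sum_mset_Suc_eq_1[of K'] KL 1 by (auto simp: fits_def)
  next
    case 2
    then have "y + ?S L' = Suc z" using eq assms by simp
    then have "?S L' = 1" using assms by linarith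
    then show False using sum_mset_Suc_eq_1[of L'] KL 2 by (auto simp: fits_def)
  qed
qed

lemma pair_mset_eq: "{#a, b#} = {#c, d#} \<longleftrightarrow> a = c \<and> b = d \<or> a = d \<and> b = c"
  by (auto simp: add_eq_conv_ex add_mset_commute)

lemma rel_mset_singleD: "rel_mset R A {#y#} \<Longrightarrow> \<exists>a. A = {#a#} \<and> R a y"
  using msed_rel_invR[of R A y "{#}"] by auto

lemma rel_mset_pairD: "rel_mset R A {#y, z#} \<Longrightarrow> \<exists>a b. A = {#a, b#} \<and> R a y \<and> R b z"
  using msed_rel_invR[of R A y "{#z#}"] rel_mset_singleD[of R _ z] by blast

lemma rel_mset_pairI: "R a y \<Longrightarrow> R b z \<Longrightarrow> rel_mset R {#a, b#} {#y, z#}"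
  by (intro rel_mset_Plus) auto

lemma saturated_single:
  assumes "3 \<le> y"
  shows "{A. saturated A {#y#}} = {{#y#}, {#y - 1#}}"
proof (intro set_eqI iffI)
  fix A assume "A \<in> {A. saturated A {#y#}}"
  then have "rel_mset near A {#y#}"
    using saturated_iff[of "{#y#}" A] assms by simp
  then show "A \<in> {{#y#}, {#y - 1#}}" by (auto dest: rel_mset_singleD)
next
  fix A assume A: "A \<in> {{#y#}, {#y - 1#}}"
  obtain a where a: "A = {#a#}" "near a y" using A assms by auto
  have "rel_mset near {#a#} {#y#}" using rel_mset_Plus[of near a y "{#}" "{#}"] a(2) by simp
  moreover have "\<not> packs {#1, a#} {#y#}" using a by (auto simp: packs_single)
  ultimately show "A \<in> {A. saturated A {#y#}}" using saturated_iff[of "{#y#}" A] assms a by simp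
qed

text \<open>If at most one of the components shrinks, an additional isolated vertex exceeds the
  total capacity. Shrinking both is the delicate case.\<close>

lemma saturated_pair:
  assumes "z \<le> y" "3 \<le> z"
  shows "{A. saturated A {#y, z#}} = {{#y, z#}, {#y - 1, z#}, {#y, z - 1#}} \<union>
    (if y = Suc z then {} else {{#y - 1, z - 1#}})" (is "_ = ?X \<union> ?Y")
proof (intro set_eqI iffI)
  have 3: "\<forall>x\<in>#{#y, z#}. 3 \<le> x" using assms by auto
  {
    fix A assume "A \<in> {A. saturated A {#y, z#}}"
    then have A: "rel_mset near A {#y, z#}" "\<not> packs (add_mset 1 A) {#y, z#}"
      using saturated_iff[OF 3, of A] by simp_all
    obtain a b where ab: "A = {#a, b#}" "near a y" "near b z" using rel_mset_pairD[OF A(1)] by blast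
    \<comment> \<open>The exceptional case: the shrunk larger component fills the bin
      \<open>z\<close>, and \<open>z - 1\<close> shares the bin \<open>Suc z\<close> with the
      isolated vertex.\<close>
    have "packs {#1, z, z - 1#} {#Suc z, z#}"
      using packs_add_pair[of "{#z#}" "{#z#}" 1 "z - 1" "Suc z"] assms packs_refl[of "{#z#}"]
      by (simp add: add_mset_commute)
    then have "\<not> (y = Suc z \<and> A = {#y - 1, z - 1#})" using A(2) by auto
    then show "A \<in> ?X \<union> ?Y" using ab by auto
  next
    fix A assume A: "A \<in> ?X \<union> ?Y"
    have *: "near y y" "near (y - 1) y" "near z z" "near (z - 1) z" using assms by auto
    have "A = {#y, z#} \<or> A = {#y - 1, z#} \<or> A = {#y, z - 1#} \<or> A = {#y - 1, z - 1#}"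
      using A by (auto split: if_splits)
    then have "rel_mset near A {#y, z#}"
      using rel_mset_pairI[of near, OF *(1) *(3)] rel_mset_pairI[of near, OF *(2) *(3)]
        rel_mset_pairI[of near, OF *(1) *(4)] rel_mset_pairI[of near, OF *(2) *(4)] by auto
    moreover have "\<not> packs (add_mset 1 A) {#y, z#}"
    proof (cases "A \<in> ?X")
      case True
      then show ?thesis using packs_weight[of "add_mset 1 A" "{#y, z#}"] assms by auto
    next
      case False
      then show ?thesis using A not_packs_near_pair[OF assms] by (auto split: if_splits)
    qed
    ultimately show "A \<in> {A. saturated A {#y, z#}}" using saturated_iff[OF 3, of A] by simp
  }
qed

text \<open>The list is sorted increasingly, so \<open>a\<close> is the smaller component in the last proper case.\<close>

definition fib_weight :: "nat multiset \<Rightarrow> int" where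
  "fib_weight A = (case sorted_list_of_multiset A of
     [] \<Rightarrow> 1
   | [a] \<Rightarrow> (-1) ^ Suc a
   | [a, b] \<Rightarrow> (-1) ^ (a + b) * int (fib (if a = b then a - 2 else a))
   | _ \<Rightarrow> 0)"

lemma fib_weight_empty [simp]: "fib_weight {#} = 1"
  by (simp add: fib_weight_def)

lemma fib_weight_single [simp]: "fib_weight {#a#} = (-1) ^ Suc a"
  by (simp add: fib_weight_def)

lemma fib_weight_pair: "b \<le> a \<Longrightarrow>
    fib_weight {#a, b#} = (-1) ^ (a + b) * int (fib (if a = b then b - 2 else b))"
  by (auto simp: fib_weight_def add.commute)

lemma size_le_2_cases:
  fixes A :: "nat multiset"
  assumes "size A \<le> 2"
  shows "A = {#} \<or> (\<exists>a. A = {#a#}) \<or> (\<exists>a b. b \<le> a \<and> A = {#a, b#})"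
proof -
  consider "size A = 0" | "size A = 1" | "size A = Suc 1" using assms by linarith
  then show ?thesis
  proof cases
    case 1
    then show ?thesis by simp
  next
    case 2
    then show ?thesis by (metis size_1_singleton_mset)
  next
    case 3
    then obtain a A' where A': "A = add_mset a A'" by (metis size_eq_Suc_imp_eq_union)
    then have "size A' = 1" using 3 by simp
    then obtain b where "A' = {#b#}" by (metis size_1_singleton_mset)
    then have "A = {#a, b#}" "A = {#b, a#}" using A' by (simp_all add: add_mset_commute)
    then show ?thesis by (metis nat_le_linear)
  qed
qed

text \<open>By \<open>saturated_pair\<close>, the cases \<open>y = z\<close> and
  \<open>y = Suc z\<close> amount to the Fibonacci recursion at \<open>z - 1\<close> and at
  \<open>z\<close>. For larger \<open>y\<close> the four terms cancel in pairs.\<close>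

lemma fib_weight_sum:
  assumes "0 \<notin># B" "1 \<notin># B" "size B \<le> 2"
  shows "(\<Sum>A | saturated A B. fib_weight A) = (if B = {#} then 1 else 0)"
proof (cases "2 \<in># B")
  case True
  have "(\<Sum>A | saturated A B. fib_weight A) = 0"
  proof (rule sum_saturated_two[OF True])
    fix A assume A: "saturated (add_mset 2 A) B" "2 \<notin># A"
    then have *: "size A < 2" "1 \<notin># A" "0 \<notin># A"
      using saturated_size[OF A(1)] assms packs_pos[of "add_mset 2 A" B] by (auto simp: saturated_def)
    then consider "A = {#}" | a where "A = {#a#}" | a b where "A = {#a, b#}"
      using size_le_2_cases[of A] by (metis less_imp_le)
    then show "fib_weight (add_mset 2 A) = - fib_weight A"
    proof cases
      case (2 a)
      then have "a \<noteq> 0" "a \<noteq> 1" "a \<noteq> 2" using * A(2) by auto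
      then have a: "3 \<le> a" by linarith
      \<comment> \<open>The smaller component contributes \<open>fib 2 = 1\<close>, so only the sign
        differs.\<close>
      then have "fib_weight {#a, 2#} = - fib_weight {#a#}" by (subst fib_weight_pair) auto
      then show ?thesis using 2 by (simp add: add_mset_commute)
    qed (use * in auto)
  next
    fix A assume A: "saturated A B" "2 \<le> count A 2"
    then have "size A \<le> 2" using saturated_size[OF A(1)] assms by simp
    then consider "A = {#}" | a where "A = {#a#}" | a b where "b \<le> a" "A = {#a, b#}"
      using size_le_2_cases[of A] by metis
    \<comment> \<open>The only possibility is \<open>{#2, 2#}\<close>, whose weight is
      \<open>fib 0 = 0\<close>.\<close>
    then show "fib_weight A = 0" using A(2) by cases (auto simp: fib_weight_pair split: if_splits)
  qed
  then show ?thesis using True by auto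
next
  case False
  have 3: "3 \<le> x" if "x \<in># B" for x
  proof -
    have "x \<noteq> 0" "x \<noteq> 1" "x \<noteq> 2" using that False assms by metis+
    then show ?thesis by linarith
  qed
  consider "B = {#}" | y where "B = {#y#}" | z y where "z \<le> y" "B = {#y, z#}"
    using size_le_2_cases[OF assms(3)] by metis
  then show ?thesis
  proof cases
    case 1
    have "{A. saturated A {#}} = {{#}}" using saturated_refl[of "{#}"] by (auto simp: saturated_def)
    then show ?thesis using 1 by simp
  next
    case (2 y)
    then have y: "3 \<le> y" using 3 by simp
    then show ?thesis unfolding 2 saturated_single[OF y] by (cases y) auto
  next
    case (3 z y)
    then have z: "3 \<le> z" using \<open>\<And>x. x \<in># B \<Longrightarrow> 3 \<le> x\<close> by simp
    define v where "v = z - 3"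
    have v: "z = Suc (Suc (Suc v))" using z by (simp add: v_def)
    consider "y = z" | "y = Suc z" | "Suc (Suc z) \<le> y" using 3 by linarith
    then have "(\<Sum>A | saturated A {#y, z#}. fib_weight A) = 0"
    proof cases
      case 1
      have "{A. saturated A {#y, z#}} = {{#z, z#}, {#z, z - 1#}, {#z - 1, z - 1#}}"
        using saturated_pair[OF 3(1) z] 1 by (auto simp: add_mset_commute)
      then show ?thesis by (simp add: fib_weight_pair v pair_mset_eq)
    next
      case 2
      have "{A. saturated A {#y, z#}} = {{#Suc z, z#}, {#z, z#}, {#Suc z, z - 1#}}"
        using saturated_pair[OF 3(1) z] 2 by simp
      then show ?thesis by (simp add: fib_weight_pair v pair_mset_eq)
    next
      case 3
      define u where "u = y - z - 2"
      have u: "y = Suc (Suc (z + u))" using 3 by (simp add: u_def)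
      have "{A. saturated A {#y, z#}} = {{#y, z#}, {#y - 1, z#}, {#y, z - 1#}, {#y - 1, z - 1#}}"
        using saturated_pair[OF \<open>z \<le> y\<close> z] u by auto
      then show ?thesis by (simp add: fib_weight_pair u v pair_mset_eq)
    qed
    then show ?thesis using 3 by simp
  qed
qed

context forest_moebius
begin

lemma g_eq_fib_weight:
  assumes "0 \<notin># B" "1 \<notin># B" "size B = n" "n \<le> 2"
  shows "g B = fib_weight B"
proof (rule g_unique)
  let ?B = "{B. 0 \<notin># B \<and> 1 \<notin># B \<and> size B \<le> n}"
  show "\<And>B. B \<in> ?B \<Longrightarrow> 0 \<notin># B \<and> 1 \<notin># B \<and> size B \<le> n" by simp
  show "A \<in> ?B" if "B \<in> ?B" "saturated A B" for A B
    using that saturated_size[of A B] packs_pos[of A B] by (simp add: saturated_def)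
  show "\<And>B. B \<in> ?B \<Longrightarrow> (\<Sum>A | saturated A B. fib_weight A) = (if B = {#} then 1 else 0)"
    using fib_weight_sum assms(4) by simp
qed (use assms in auto)

end

section \<open>Components with at most five vertices\<close>

text \<open>The number of Motzkin paths with \<open>i + k\<close> up, \<open>j\<close> level and \<open>i\<close> down steps that stay weakly
  above their starting height, by the type of the last step.\<close>

function motzkin :: "nat \<Rightarrow> nat \<Rightarrow> nat \<Rightarrow> int" where
  "motzkin i j k = (if i = 0 \<and> j = 0 \<and> k = 0 then 1 else
     (if j = 0 then 0 else motzkin i (j - 1) k) +
     (if k = 0 then 0 else motzkin i j (k - 1)) +
     (if i = 0 then 0 else motzkin (i - 1) j (Suc k)))"
  by auto
termination by (relation "measure (\<lambda>(i, j, k). 2 * i + j + k)") auto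

declare motzkin.simps [simp del]

lemma motzkin_0_0 [simp]: "motzkin 0 0 k = 1"
  by (induction k) (simp_all add: motzkin.simps[of 0 0])

lemma motzkin_0_j_0 [simp]: "motzkin 0 j 0 = 1"
  by (induction j) (simp_all add: motzkin.simps[of 0 _ 0])

text \<open>Ballot numbers in the form given by the reflection principle: for
  \<open>2 * i \<le> N\<close> they count paths of \<open>N\<close> up and down steps,
  \<open>i\<close> of them down, that never fall below the start.\<close>

definition ballot :: "nat \<Rightarrow> nat \<Rightarrow> int" where
  "ballot N i = int (N choose i) - (if i = 0 then 0 else int (N choose (i - 1)))"

lemma ballot_Suc: "ballot (Suc N) (Suc i) = ballot N (Suc i) + ballot N i"
  by (cases i) (simp_all add: ballot_def)

text \<open>Without level steps the recursion of \<open>motzkin\<close> is the Pascal rule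
  \<open>ballot_Suc\<close>.\<close>

lemma motzkin_ballot: "motzkin i 0 k = ballot (2 * i + k) i"
proof (induction i arbitrary: k)
  case 0
  show ?case by (simp add: ballot_def)
next
  case (Suc i)
  show ?case
  proof (induction k)
    case 0
    \<comment> \<open>The two middle binomials agree, so the term of \<open>ballot_Suc\<close> that
      has no counterpart for \<open>k = 0\<close> vanishes.\<close>
    have "Suc (2 * i) choose Suc i = Suc (2 * i) choose i"
      using binomial_symmetric[of i "Suc (2 * i)"] by (simp add: Suc_diff_le)
    then have "ballot (Suc (2 * i)) (Suc i) = 0" by (simp add: ballot_def)
    then show ?case using Suc.IH[of 1] ballot_Suc[of "Suc (2 * i)" i]
      by (simp add: motzkin.simps[of "Suc i"])
  next
    case (Suc k)
    then show ?case
      using \<open>\<And>k. motzkin i 0 k = ballot (2 * i + k) i\<close>[of "Suc (Suc k)"]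
        ballot_Suc[of "Suc (Suc (2 * i + k))" i]
      by (simp add: motzkin.simps[of "Suc i"])
  qed
qed

lemma motzkin_catalan: "rat_of_int (motzkin n 0 0) = catalan n"
proof (cases n)
  case 0
  then show ?thesis by (simp add: catalan_def)
next
  case (Suc m)
  let ?N = "2 * Suc m"
  \<comment> \<open>The ratio of neighbouring binomials turns their difference into the closed form
    of the Catalan number.\<close>
  have "Suc m * (?N choose Suc m) = (?N - m) * (?N choose m)"
    by (simp only: binomial_absorption binomial_absorb_comp)
  also have "?N - m = m + 2" by simp
  finally have "Suc m * (?N choose Suc m) = (m + 2) * (?N choose m)" .
  then have "(of_nat (Suc m) :: rat) * of_nat (?N choose Suc m) = (of_nat m + 2) * of_nat (?N choose m)"
    by (metis of_nat_add of_nat_mult of_nat_numeral)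
  then show ?thesis
    unfolding Suc motzkin_ballot catalan_def
    by (simp add: ballot_def field_simps)
qed

definition signed_motzkin :: "nat \<Rightarrow> nat \<Rightarrow> nat \<Rightarrow> int" where
  "signed_motzkin i j k = (-1) ^ j * motzkin i j k"

lemma signed_motzkin_rec:
  "signed_motzkin i j k = (if i = 0 \<and> j = 0 \<and> k = 0 then 1 else
     - (if j = 0 then 0 else signed_motzkin i (j - 1) k) +
     (if k = 0 then 0 else signed_motzkin i j (k - 1)) +
     (if i = 0 then 0 else signed_motzkin (i - 1) j (Suc k)))"
  unfolding signed_motzkin_def
  by (subst motzkin.simps) (cases j; simp add: algebra_simps)

text \<open>For \<open>N > 0\<close> the level and down terms of the recursion run over the
  preceding diagonal, with last argument \<open>r\<close> and \<open>Suc r\<close>. Both sums have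
  the same value by induction and cancel. What remains reduces \<open>r\<close> to
  \<open>r - 1\<close>, and to 0 for \<open>r = 0\<close>.\<close>

lemma signed_motzkin_diagonal: "(\<Sum>i\<le>N. signed_motzkin i (N - i) r) = (if N = 0 then 1 else 0)"
proof (induction N arbitrary: r)
  case 0
  show ?case by (simp add: signed_motzkin_def)
next
  case (Suc N)
  have step: "(\<Sum>i\<le>Suc N. signed_motzkin i (Suc N - i) r) = (if r = 0 then 0 else \<Sum>i\<le>Suc N. signed_motzkin i (Suc N - i) (r - 1))"
    for r
  proof -
    have "(\<Sum>i\<le>Suc N. signed_motzkin i (Suc N - i) r) =
        (\<Sum>i\<le>Suc N. - (if Suc N - i = 0 then 0 else signed_motzkin i (Suc N - i - 1) r) +
          (if r = 0 then 0 else signed_motzkin i (Suc N - i) (r - 1)) +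
          (if i = 0 then 0 else signed_motzkin (i - 1) (Suc N - i) (Suc r)))"
      by (rule sum.cong[OF refl], subst signed_motzkin_rec) auto
    also have "\<dots> = - (\<Sum>i\<le>Suc N. if Suc N - i = 0 then 0 else signed_motzkin i (Suc N - i - 1) r) +
        (\<Sum>i\<le>Suc N. if r = 0 then 0 else signed_motzkin i (Suc N - i) (r - 1)) +
        (\<Sum>i\<le>Suc N. if i = 0 then 0 else signed_motzkin (i - 1) (Suc N - i) (Suc r))"
      by (simp only: sum.distrib sum_negf)
    also have "(\<Sum>i\<le>Suc N. if Suc N - i = 0 then 0 else signed_motzkin i (Suc N - i - 1) r) = (\<Sum>i\<le>N. signed_motzkin i (N - i) r)"
      by simp
    also have "(\<Sum>i\<le>Suc N. if i = 0 then 0 else signed_motzkin (i - 1) (Suc N - i) (Suc r)) =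
        (\<Sum>i\<le>N. signed_motzkin i (N - i) (Suc r))"
      by (subst sum.atMost_Suc_shift) simp
    finally show ?thesis using Suc.IH by simp
  qed
  show ?case
    by (induction r) (use step in auto)
qed

text \<open>The saturated recursion for \<open>p\<close>, \<open>q\<close>, \<open>r\<close>
  components of sizes 5, 4, 3. Expanding the terms of the first sum by
  \<open>signed_motzkin_rec\<close> reduces the pair \<open>Suc q\<close>, \<open>r\<close> to
  \<open>q\<close>, \<open>Suc r\<close>; for \<open>q = 0\<close> only full diagonals
  remain.\<close>

lemma signed_motzkin_identity:
  "(\<Sum>i\<le>p. signed_motzkin i (p + q - i) r) + (\<Sum>m<q. signed_motzkin p m (q - m + r)) -
     (if r = 0 then 0 else \<Sum>i\<le>p. signed_motzkin i (p + q - i) (r - 1)) =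
   (if p = 0 \<and> q = 0 \<and> r = 0 then 1 else 0)"
proof (induction q arbitrary: r)
  case 0
  show ?case by (simp add: signed_motzkin_diagonal)
next
  case (Suc q)
  let ?N = "p + Suc q"
  have "(\<Sum>i\<le>p. signed_motzkin i (?N - i) r) =
      (\<Sum>i\<le>p. - signed_motzkin i (p + q - i) r + (if r = 0 then 0 else signed_motzkin i (?N - i) (r - 1)) +
        (if i = 0 then 0 else signed_motzkin (i - 1) (?N - i) (Suc r)))"
    by (rule sum.cong[OF refl], subst signed_motzkin_rec) (auto simp: Suc_diff_le)
  also have "\<dots> = - (\<Sum>i\<le>p. signed_motzkin i (p + q - i) r) +
      (\<Sum>i\<le>p. if r = 0 then 0 else signed_motzkin i (?N - i) (r - 1)) +
      (\<Sum>i\<le>p. if i = 0 then 0 else signed_motzkin (i - 1) (?N - i) (Suc r))"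
    by (simp only: sum.distrib sum_negf)
  also have "(\<Sum>i\<le>p. if i = 0 then 0 else signed_motzkin (i - 1) (?N - i) (Suc r)) =
      (\<Sum>i<p. signed_motzkin i (p + q - i) (Suc r))"
  proof (cases p)
    case (Suc p')
    then show ?thesis
      by (simp add: sum.atMost_Suc_shift lessThan_Suc_atMost del: sum.atMost_Suc sum.lessThan_Suc)
  qed simp
  finally have 1: "(\<Sum>i\<le>p. signed_motzkin i (?N - i) r) - (if r = 0 then 0 else \<Sum>i\<le>p. signed_motzkin i (?N - i) (r - 1)) =
      - (\<Sum>i\<le>p. signed_motzkin i (p + q - i) r) + (\<Sum>i<p. signed_motzkin i (p + q - i) (Suc r))"
    by simp
  have 2: "(\<Sum>m<Suc q. signed_motzkin p m (Suc q - m + r)) = (\<Sum>m<q. signed_motzkin p m (q - m + Suc r)) + signed_motzkin p q (Suc r)"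
    by (simp add: Suc_diff_le)
  have 3: "(\<Sum>i\<le>p. signed_motzkin i (p + q - i) (Suc r)) = (\<Sum>i<p. signed_motzkin i (p + q - i) (Suc r)) + signed_motzkin p q (Suc r)"
    by (simp flip: lessThan_Suc_atMost)
  show ?case using Suc.IH[of "Suc r"] 1 2 3 by simp
qed

section \<open>Saturated packings of components of sizes 2 to 5\<close>

definition forest2345 :: "nat \<Rightarrow> nat \<Rightarrow> nat \<Rightarrow> nat \<Rightarrow> nat multiset" where
  "forest2345 i j k s = replicate_mset i 5 + replicate_mset j 4 + replicate_mset k 3 + replicate_mset s 2"

lemma forest2345_inject [simp]: "forest2345 i j k s = forest2345 i' j' k' s' \<longleftrightarrow> i = i' \<and> j = j' \<and> k = k' \<and> s = s'"
proof
  assume *: "forest2345 i j k s = forest2345 i' j' k' s'"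
  show "i = i' \<and> j = j' \<and> k = k' \<and> s = s'"
    using arg_cong[OF *, of "\<lambda>A. count A 5"] arg_cong[OF *, of "\<lambda>A. count A 4"]
      arg_cong[OF *, of "\<lambda>A. count A 3"] arg_cong[OF *, of "\<lambda>A. count A 2"]
    by (simp add: forest2345_def)
qed simp

lemma ex_forest2345:
  assumes "set_mset B \<subseteq> {2..5}"
  shows "B = forest2345 (count B 5) (count B 4) (count B 3) (count B 2)"
proof (rule multiset_eqI)
  fix x
  have "x \<in> {2, 3, 4, 5}" if "x \<in># B"
    using assms that by force
  then show "count B x = count (forest2345 (count B 5) (count B 4) (count B 3) (count B 2)) x"
    by (cases "x \<in># B") (auto simp: forest2345_def not_in_iff)
qed

text \<open>A single 2 flips the sign and several give 0, as \<open>sum_saturated_two\<close>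
  demands.\<close>

definition motzkin_weight :: "nat multiset \<Rightarrow> int" where
  "motzkin_weight A = (if count A 2 \<le> 1 then (-1) ^ count A 2 * signed_motzkin (count A 5) (count A 4) (count A 3) else 0)"

lemma motzkin_weight_forest2345: "motzkin_weight (forest2345 i j k s) = (if s \<le> 1 then (-1) ^ s * signed_motzkin i j k else 0)"
  by (simp add: motzkin_weight_def forest2345_def)

lemma rel_mset_plusD:
  "rel_mset R A (X + Y) \<Longrightarrow> \<exists>A1 A2. A = A1 + A2 \<and> rel_mset R A1 X \<and> rel_mset R A2 Y"
proof (induction X arbitrary: A)
  case empty
  then show ?case by (intro exI[of _ "{#}"] exI[of _ A]) simp
next
  case (add x X)
  then have "rel_mset R A (add_mset x (X + Y))" by simp
  then obtain A' a where A': "A = add_mset a A'" "R a x" "rel_mset R A' (X + Y)"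
    using msed_rel_invR by metis
  then obtain A1 A2 where "A' = A1 + A2" "rel_mset R A1 X" "rel_mset R A2 Y"
    using add.IH by blast
  then show ?case using A'
    by (intro exI[of _ "add_mset a A1"] exI[of _ A2]) (simp add: rel_mset_Plus)
qed

lemma rel_mset_plusI:
  "rel_mset R A1 X \<Longrightarrow> rel_mset R A2 Y \<Longrightarrow> rel_mset R (A1 + A2) (X + Y)"
proof (induction X arbitrary: A1)
  case (add x X)
  then obtain A' a where A': "A1 = add_mset a A'" "R a x" "rel_mset R A' X"
    using msed_rel_invR[OF add.prems(1)] by blast
  then have "rel_mset R (A' + A2) (X + Y)" using add by blast
  then show ?case using A' by (simp add: rel_mset_Plus)
qed simp

lemma near_replicateD:
  assumes "rel_mset near A (replicate_mset p (Suc x))"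
  shows "\<exists>i\<le>p. A = replicate_mset i (Suc x) + replicate_mset (p - i) x"
  using assms
proof (induction p arbitrary: A)
  case (Suc p)
  then have *: "rel_mset near A (add_mset (Suc x) (replicate_mset p (Suc x)))" by simp
  obtain A' a where A': "A = add_mset a A'" "near a (Suc x)"
      "rel_mset near A' (replicate_mset p (Suc x))"
    using msed_rel_invR[OF *] by blast
  then obtain i where i: "i \<le> p" "A' = replicate_mset i (Suc x) + replicate_mset (p - i) x"
    using Suc.IH by blast
  from A'(2) consider "a = Suc x" | "a = x" by auto
  then show ?case
  proof cases
    case 1
    then show ?thesis using A' i by (intro exI[of _ "Suc i"]) simp
  next
    case 2
    then show ?thesis using A' i by (intro exI[of _ i]) (simp add: Suc_diff_le)
  qed
qed simp

lemma near_replicateI: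
  assumes "0 < x"
  shows "rel_mset near (replicate_mset i (Suc x) + replicate_mset p x) (replicate_mset (i + p) (Suc x))"
proof (induction p)
  case 0
  show ?case by (induction i) (auto intro!: rel_mset_Plus)
next
  case (Suc p)
  then show ?case using assms by (auto intro!: rel_mset_Plus)
qed

text \<open>\<open>i\<close>, \<open>m\<close>, \<open>l\<close> count the components of sizes 5, 4,
  3 that keep their size; each shrunk one joins the next smaller class.\<close>

lemma near_forest2345D:
  assumes "rel_mset near A (forest2345 p q r 0)"
  shows "\<exists>i m l. i \<le> p \<and> m \<le> q \<and> l \<le> r \<and> A = forest2345 i (p - i + m) (q - m + l) (r - l)"
proof -
  from assms obtain X Y Z where A: "A = X + Y + Z" "rel_mset near X (replicate_mset p (Suc 4))"
      "rel_mset near Y (replicate_mset q (Suc 3))" "rel_mset near Z (replicate_mset r (Suc 2))"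
    unfolding forest2345_def by (auto dest!: rel_mset_plusD)
  obtain i m l where "i \<le> p" "X = replicate_mset i (Suc 4) + replicate_mset (p - i) 4"
      "m \<le> q" "Y = replicate_mset m (Suc 3) + replicate_mset (q - m) 3"
      "l \<le> r" "Z = replicate_mset l (Suc 2) + replicate_mset (r - l) 2"
    using near_replicateD[OF A(2)] near_replicateD[OF A(3)] near_replicateD[OF A(4)] by blast
  then show "\<exists>i m l. i \<le> p \<and> m \<le> q \<and> l \<le> r \<and> A = forest2345 i (p - i + m) (q - m + l) (r - l)"
    using A by (intro exI[of _ i] exI[of _ m] exI[of _ l]) (auto simp: forest2345_def intro!: multiset_eqI)
qed

lemma near_forest2345I:
  assumes "i \<le> p" "m \<le> q" "l \<le> r"
  shows "rel_mset near (forest2345 i (p - i + m) (q - m + l) (r - l)) (forest2345 p q r 0)"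
proof -
  have "forest2345 i (p - i + m) (q - m + l) (r - l) = (replicate_mset i (Suc 4) + replicate_mset (p - i) 4) +
      (replicate_mset m (Suc 3) + replicate_mset (q - m) 3) +
      (replicate_mset l (Suc 2) + replicate_mset (r - l) 2)"
    unfolding forest2345_def by (auto intro!: multiset_eqI)
  moreover have "rel_mset near \<dots> (replicate_mset (i + (p - i)) (Suc 4) +
      replicate_mset (m + (q - m)) (Suc 3) + replicate_mset (l + (r - l)) (Suc 2))"
    by (intro rel_mset_plusI near_replicateI) auto
  moreover have "replicate_mset (i + (p - i)) (Suc 4) + replicate_mset (m + (q - m)) (Suc 3) +
      replicate_mset (l + (r - l)) (Suc 2) = forest2345 p q r 0"
    using assms by (simp add: forest2345_def)
  ultimately show ?thesis by (simp only:)
qed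

lemma packs_forest2345:
  assumes "i \<le> p" "m \<le> q" "l \<le> r"
  shows "packs (forest2345 i (p - i + m) (q - m + l) (r - l)) (forest2345 p q r 0)"
  by (intro rel_mset_le_packs multiset.rel_mono_strong[OF near_forest2345I[OF assms]]) auto

text \<open>Both weights are superadditive with respect to packing. The first one does not distinguish
  components of sizes 4 and 5, the second one (the independence number) those of sizes 3 and 4.\<close>

lemma not_packs_weight46:
  assumes "6 * (i + j) + 4 * k + 3 * s + 2 > 6 * (p + q) + 4 * r"
  shows "\<not> packs (add_mset 1 (forest2345 i j k s)) (forest2345 p q r 0)"
proof
  let ?f = "\<lambda>a::nat. if a = 4 then 6 else Suc a"
  assume *: "packs (add_mset 1 (forest2345 i j k s)) (forest2345 p q r 0)"
  have "(\<Sum>a\<in>#K. ?f a) \<le> ?f x" if x: "x \<in># forest2345 p q r 0" and K: "fits K x" for K x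
  proof -
    have x5: "x \<in> {3, 4, 5}" using x by (auto simp: forest2345_def split: if_splits)
    show ?thesis
    proof (cases "4 \<in># K")
      case True
      then obtain K' where K': "K = add_mset 4 K'" by (metis multi_member_split)
      \<comment> \<open>A second component beside the 4 would require a bin of size at least
        6.\<close>
      have "K' = {#}"
      proof (cases K')
        case (add a L)
        then show ?thesis using K K' x5 by (auto simp: fits_def)
      qed
      then show ?thesis using K K' x5 by auto
    next
      case False
      then have "(\<Sum>a\<in>#K. ?f a) = (\<Sum>a\<in>#K. Suc a)"
        by (intro arg_cong[of _ _ sum_mset] image_mset_cong) auto
      also have "\<dots> = sum_mset K + size K" by (rule sum_mset_Suc)
      finally show ?thesis using K x5 by (auto simp: fits_def)
    qed
  qed
  from packs_superadditive[of "forest2345 p q r 0" ?f, OF this *] show False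
    using assms by (simp add: forest2345_def)
qed

lemma not_packs_alpha:
  assumes "3 * i + 2 * (j + k) + s + 1 > 3 * p + 2 * (q + r)"
  shows "\<not> packs (add_mset 1 (forest2345 i j k s)) (forest2345 p q r 0)"
proof
  let ?f = "\<lambda>a::nat. Suc a div 2"
  assume *: "packs (add_mset 1 (forest2345 i j k s)) (forest2345 p q r 0)"
  have "(\<Sum>a\<in>#K. ?f a) \<le> ?f x" if K: "fits K x" for K x
  proof -
    have "(\<Sum>a\<in>#K. ?f a) \<le> (sum_mset K + size K) div 2" by (induction K) auto
    also have "\<dots> \<le> Suc x div 2" using K by (intro div_le_mono) (simp add: fits_def)
    finally show ?thesis .
  qed
  from packs_superadditive[of "forest2345 p q r 0" ?f, OF this *] show False
    using assms by (simp add: forest2345_def)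
qed

text \<open>If a 5 and a 4 both shrink, the resulting 4 moves into the bin of size 4, and the
  resulting 3 leaves space for an isolated vertex in the bin of size 5.\<close>

lemma packs_extra_431:
  assumes "i < p" "m < q"
  shows "packs (add_mset 1 (forest2345 i (p - i + m) (q - m + r) 0)) (forest2345 p q r 0)"
proof -
  obtain p' q' where pq: "p = Suc p'" "q = Suc q'" using assms by (metis less_imp_Suc_add)
  have "packs {#4#} {#4#}" by (intro packs_refl) auto
  then have "packs {#3, 1, 4#} {#5, 4#}" using packs_add_pair[of "{#4#}" "{#4#}" 3 1 5] by simp
  then have "packs (forest2345 i (p' - i + m) (q' - m + r) (r - r) + {#3, 1, 4#}) (forest2345 p' q' r 0 + {#5, 4#})"
    using assms pq by (intro packs_plus packs_forest2345) auto
  moreover have "forest2345 i (p' - i + m) (q' - m + r) (r - r) + {#3, 1, 4#} =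
      add_mset 1 (forest2345 i (p - i + m) (q - m + r) 0)"
    using assms pq by (intro multiset_eqI) (auto simp: forest2345_def)
  moreover have "forest2345 p' q' r 0 + {#5, 4#} = forest2345 p q r 0"
    using pq by (intro multiset_eqI) (auto simp: forest2345_def)
  ultimately show ?thesis by (simp only:)
qed

text \<open>The same exchange one size lower: the 3 moves into the bin of size 3, and the 2 shares
  the bin of size 4 with the isolated vertex.\<close>

lemma packs_extra_321:
  assumes "i \<le> p" "m < q" "l < r"
  shows "packs (add_mset 1 (forest2345 i (p - i + m) (q - m + l) (r - l))) (forest2345 p q r 0)"
proof -
  obtain q' r' where qr: "q = Suc q'" "r = Suc r'" using assms by (metis less_imp_Suc_add)
  have "packs {#3#} {#3#}" by (intro packs_refl) auto
  then have "packs {#2, 1, 3#} {#4, 3#}" using packs_add_pair[of "{#3#}" "{#3#}" 2 1 4] by simp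
  then have "packs (forest2345 i (p - i + m) (q' - m + l) (r' - l) + {#2, 1, 3#}) (forest2345 p q' r' 0 + {#4, 3#})"
    using assms qr by (intro packs_plus packs_forest2345) auto
  moreover have "forest2345 i (p - i + m) (q' - m + l) (r' - l) + {#2, 1, 3#} =
      add_mset 1 (forest2345 i (p - i + m) (q - m + l) (r - l))"
    using assms qr by (intro multiset_eqI) (auto simp: forest2345_def)
  moreover have "forest2345 p q' r' 0 + {#4, 3#} = forest2345 p q r 0"
    using qr by (intro multiset_eqI) (auto simp: forest2345_def)
  ultimately show ?thesis by (simp only:)
qed

text \<open>The two exchanges forbid shrinking a 4 together with a 5 or a 3. So either no 4 shrinks,
  with all 3s kept or exactly one shrunk, or only 4s shrink. The range \<open>{..<q}\<close> avoids
  listing the unshrunk forest twice. Conversely, \<open>not_packs_weight46\<close> handles the first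
  and third families, and \<open>not_packs_alpha\<close> the second.\<close>

lemma saturated_forest2345:
  "{A. saturated A (forest2345 p q r 0) \<and> count A 2 \<le> 1} =
    (\<lambda>i. forest2345 i (p + q - i) r 0) ` {..p} \<union> (\<lambda>m. forest2345 p m (q - m + r) 0) ` {..<q} \<union>
    (if r = 0 then {} else (\<lambda>i. forest2345 i (p + q - i) (r - 1) 1) ` {..p})"
    (is "?S = ?X \<union> ?Y \<union> ?Z")
proof (intro set_eqI iffI)
  have 3: "\<forall>x\<in>#forest2345 p q r 0. 3 \<le> x" by (auto simp: forest2345_def split: if_splits)
  {
    fix A assume "A \<in> ?S"
    then have A: "rel_mset near A (forest2345 p q r 0)" "\<not> packs (add_mset 1 A) (forest2345 p q r 0)" "count A 2 \<le> 1"
      using saturated_iff[OF 3, of A] by auto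
    obtain i m l where iml: "i \<le> p" "m \<le> q" "l \<le> r" "A = forest2345 i (p - i + m) (q - m + l) (r - l)"
      using near_forest2345D[OF A(1)] by blast
    have "r - l \<le> 1" using A(3) iml by (simp add: forest2345_def)
    then consider "l = r" | "r = Suc l" using iml by linarith
    then show "A \<in> ?X \<union> ?Y \<union> ?Z"
    proof cases
      case 1
      then have "A = forest2345 i (p - i + m) (q - m + r) 0" using iml by simp
      then have "\<not> (i < p \<and> m < q)" using packs_extra_431[of i p m q r] A(2) by metis
      then have "m = q \<or> i = p" using iml by linarith
      then show ?thesis
      proof (cases "m = q")
        case True
        then have "A = forest2345 i (p + q - i) r 0" using iml 1 by simp
        then show ?thesis using iml by blast
      next
        case False
        then have "A = forest2345 p m (q - m + r) 0" "m < q" using iml 1 \<open>m = q \<or> i = p\<close> by auto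
        then show ?thesis by blast
      qed
    next
      case 2
      then have "\<not> m < q" using packs_extra_321[of i p m q l r] A(2) iml by fastforce
      then have "m = q" using iml by simp
      then have "A = forest2345 i (p + q - i) (r - 1) 1" using iml 2 by simp
      then show ?thesis using iml 2 by auto
    qed
  next
    fix A assume "A \<in> ?X \<union> ?Y \<union> ?Z"
    then consider i where "i \<le> p" "A = forest2345 i (p + q - i) r 0"
      | m where "m < q" "A = forest2345 p m (q - m + r) 0"
      | i where "i \<le> p" "0 < r" "A = forest2345 i (p + q - i) (r - 1) 1"
      by (auto split: if_splits)
    then show "A \<in> ?S"
    proof cases
      case 1
      then have "rel_mset near A (forest2345 p q r 0)" using near_forest2345I[of i p q q r r] by simp
      moreover have "\<not> packs (add_mset 1 A) (forest2345 p q r 0)"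
        unfolding 1 using 1(1) by (intro not_packs_weight46) simp
      ultimately show ?thesis using saturated_iff[OF 3, of A] 1 by (simp add: forest2345_def)
    next
      case 2
      then have "rel_mset near A (forest2345 p q r 0)" using near_forest2345I[of p p m q r r] by simp
      moreover have "\<not> packs (add_mset 1 A) (forest2345 p q r 0)"
        unfolding 2 using 2(1) by (intro not_packs_alpha) simp
      ultimately show ?thesis using saturated_iff[OF 3, of A] 2 by (simp add: forest2345_def)
    next
      case 3
      then have "rel_mset near A (forest2345 p q r 0)" using near_forest2345I[of i p q q "r - 1" r] by simp
      moreover have "\<not> packs (add_mset 1 A) (forest2345 p q r 0)"
        unfolding 3 using 3(1,2) by (intro not_packs_weight46) (cases r; simp)
      ultimately show ?thesis using saturated_iff[of "forest2345 p q r 0" A] \<open>\<forall>x\<in>#forest2345 p q r 0. 3 \<le> x\<close> 3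
        by (simp add: forest2345_def)
    qed
  }
qed

text \<open>The three families yield the three sums of \<open>signed_motzkin_identity\<close>; the
  single 2 in the last family accounts for the minus sign.\<close>

lemma motzkin_weight_sum_forest2345:
  "(\<Sum>A | saturated A (forest2345 p q r 0). motzkin_weight A) = (if p = 0 \<and> q = 0 \<and> r = 0 then 1 else 0)"
proof -
  let ?X = "(\<lambda>i. forest2345 i (p + q - i) r 0) ` {..p}" and ?Y = "(\<lambda>m. forest2345 p m (q - m + r) 0) ` {..<q}"
    and ?Z = "if r = 0 then {} else (\<lambda>i. forest2345 i (p + q - i) (r - 1) 1) ` {..p}"
  have fin: "finite ?X" "finite ?Y" "finite ?Z" by auto
  have "(\<Sum>A | saturated A (forest2345 p q r 0). motzkin_weight A) = (\<Sum>A | saturated A (forest2345 p q r 0) \<and> count A 2 \<le> 1. motzkin_weight A)"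
    by (intro sum.mono_neutral_right finite_saturated) (auto simp: motzkin_weight_def)
  also have "\<dots> = (\<Sum>A\<in>?X \<union> ?Y \<union> ?Z. motzkin_weight A)" unfolding saturated_forest2345 ..
  also have "\<dots> = (\<Sum>A\<in>?X \<union> ?Y. motzkin_weight A) + (\<Sum>A\<in>?Z. motzkin_weight A)"
    using fin by (intro sum.union_disjoint) auto
  also have "(\<Sum>A\<in>?X \<union> ?Y. motzkin_weight A) = (\<Sum>A\<in>?X. motzkin_weight A) + (\<Sum>A\<in>?Y. motzkin_weight A)"
    using fin by (intro sum.union_disjoint) auto
  also have "(\<Sum>A\<in>?X. motzkin_weight A) = (\<Sum>i\<le>p. signed_motzkin i (p + q - i) r)"
    by (subst sum.reindex) (auto simp: inj_on_def motzkin_weight_forest2345)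
  also have "(\<Sum>A\<in>?Y. motzkin_weight A) = (\<Sum>m<q. signed_motzkin p m (q - m + r))"
    by (subst sum.reindex) (auto simp: inj_on_def motzkin_weight_forest2345)
  also have "(\<Sum>A\<in>?Z. motzkin_weight A) = - (if r = 0 then 0 else \<Sum>i\<le>p. signed_motzkin i (p + q - i) (r - 1))"
  proof (cases "r = 0")
    case False
    have "(\<Sum>A\<in>(\<lambda>i. forest2345 i (p + q - i) (r - 1) 1) ` {..p}. motzkin_weight A) =
        (\<Sum>i\<le>p. - signed_motzkin i (p + q - i) (r - 1))"
      by (subst sum.reindex) (auto simp: inj_on_def motzkin_weight_forest2345)
    then show ?thesis using False by (simp add: sum_negf)
  qed simp
  finally show ?thesis using signed_motzkin_identity[of p q r] by simp
qed

lemma motzkin_weight_sum: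
  assumes "set_mset B \<subseteq> {2..5}"
  shows "(\<Sum>A | saturated A B. motzkin_weight A) = (if B = {#} then 1 else 0)"
proof (cases "2 \<in># B")
  case True
  have "(\<Sum>A | saturated A B. motzkin_weight A) = 0"
  proof (rule sum_saturated_two[OF True])
    fix A :: "nat multiset" assume "2 \<notin># A"
    then have "count A 2 = 0" by (simp add: not_in_iff)
    then show "motzkin_weight (add_mset 2 A) = - motzkin_weight A" by (simp add: motzkin_weight_def)
  qed (simp add: motzkin_weight_def)
  then show ?thesis using True by auto
next
  case False
  then have "count B 2 = 0" by (simp add: not_in_iff)
  then obtain p q r where B: "B = forest2345 p q r 0" using ex_forest2345[OF assms] by metis
  then have "B = {#} \<longleftrightarrow> p = 0 \<and> q = 0 \<and> r = 0" by (simp add: forest2345_def)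
  then show ?thesis using motzkin_weight_sum_forest2345[of p q r] B by simp
qed

context forest_moebius
begin

lemma g_eq_motzkin_weight:
  assumes "set_mset B \<subseteq> {2..5}" "size B = n"
  shows "g B = motzkin_weight B"
proof (rule g_unique)
  let ?B = "{B :: nat multiset. set_mset B \<subseteq> {2..5} \<and> size B \<le> n}"
  show "0 \<notin># B \<and> 1 \<notin># B \<and> size B \<le> n" if "B \<in> ?B" for B
    using that by force
  show "A \<in> ?B" if B: "B \<in> ?B" and A: "saturated A B" for A B
  proof -
    have "a \<in> {2..5}" if a: "a \<in># A" for a
    proof -
      have "0 \<notin># A" "1 \<notin># A" using A packs_pos[of A B] by (simp_all add: saturated_def)
      then have "a \<noteq> 0" "a \<noteq> 1" using a by metis+
      moreover obtain x where "x \<in># B" "a \<le> x" using packs_le[of A B a] a A by (auto simp: saturated_def)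
      ultimately show ?thesis using B by force
    qed
    then show ?thesis using B saturated_size[OF A] by auto
  qed
  show "(\<Sum>A | saturated A B. motzkin_weight A) = (if B = {#} then 1 else 0)" if "B \<in> ?B" for B
    using that motzkin_weight_sum by simp
qed (use assms in auto)

end

section \<open>Linear forests as graphs\<close>

text \<open>Every linear forest is the subgraph of the one-way infinite path induced by a finite set.\<close>

definition line :: "nat set \<Rightarrow> nat multigraph" where
  "line S = Multigraph S {#Upair i (Suc i). i \<in># mset_set {i. i \<in> S \<and> Suc i \<in> S}#}"

definition adj :: "nat \<Rightarrow> nat \<Rightarrow> bool" where
  "adj i j \<longleftrightarrow> j = Suc i \<or> i = Suc j"

definition line_edges :: "nat set \<Rightarrow> nat uprod set" where
  "line_edges S = {Upair i j | i j. i \<in> S \<and> j \<in> S \<and> adj i j}"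

text \<open>Isomorphism expressed by adjacency of vertices alone, which avoids edge multisets;
  \<open>graph_iso_line\<close> shows that it is graph isomorphism of lines.\<close>

definition line_iso :: "nat set \<Rightarrow> nat set \<Rightarrow> bool" where
  "line_iso S T \<longleftrightarrow> (\<exists>f. bij_betw f S T \<and> (\<forall>i\<in>S. \<forall>j\<in>S. adj (f i) (f j) \<longleftrightarrow> adj i j))"

lemma verts_line [simp]: "verts (line S) = S"
  by (simp add: line_def)

lemma edges_line:
  assumes "finite S"
  shows "edges (line S) = mset_set (line_edges S)"
proof -
  have "inj_on (\<lambda>i. Upair i (Suc i)) {i. i \<in> S \<and> Suc i \<in> S}" by (auto simp: inj_on_def)
  then have "edges (line S) = mset_set ((\<lambda>i. Upair i (Suc i)) ` {i. i \<in> S \<and> Suc i \<in> S})"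
    by (simp add: line_def image_mset_mset_set)
  also have "(\<lambda>i. Upair i (Suc i)) ` {i. i \<in> S \<and> Suc i \<in> S} = line_edges S"
    by (auto simp: line_edges_def adj_def)
  finally show ?thesis .
qed

lemma line_eqI:
  assumes "finite S" "verts G = S" "edges G = mset_set (line_edges S)"
  shows "G = line S"
  using assms edges_line[of S] by (cases G; cases "line S") (metis multigraph.sel verts_line)

lemma Upair_in_line_edges: "Upair i j \<in> line_edges S \<longleftrightarrow> i \<in> S \<and> j \<in> S \<and> adj i j"
  by (auto simp: line_edges_def adj_def)

lemma finite_line_edges:
  assumes "finite S" shows "finite (line_edges S)"
proof -
  have "line_edges S \<subseteq> (\<lambda>(i, j). Upair i j) ` (S \<times> S)" by (auto simp: line_edges_def)
  then show ?thesis using assms by (meson finite_SigmaI finite_imageI finite_subset)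
qed

lemma set_uprod_line_edges: "e \<in> line_edges S \<Longrightarrow> set_uprod e \<subseteq> S"
  by (auto simp: line_edges_def)

lemma finite_graph_line: "finite S \<Longrightarrow> finite_graph (line S)"
  by (simp add: finite_graph_def edges_line finite_line_edges set_uprod_line_edges)

lemma induce_line:
  assumes "finite S" "W \<subseteq> S"
  shows "induce (line S) W = line W"
proof (rule line_eqI)
  have "{e \<in> line_edges S. set_uprod e \<subseteq> W} = line_edges W"
    using assms by (auto simp: line_edges_def) blast
  then show "edges (induce (line S) W) = mset_set (line_edges W)"
    using assms by (simp add: edges_line filter_mset_mset_set finite_line_edges)
qed (use assms finite_subset in auto)

lemma map_uprod_line_edges:
  "map_uprod f ` line_edges S = {Upair (f i) (f j) | i j. i \<in> S \<and> j \<in> S \<and> adj i j}"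
  by (force simp: line_edges_def)

lemma inj_on_map_uprod:
  assumes "inj_on f S"
  shows "inj_on (map_uprod f) (line_edges S)"
proof (rule inj_onI)
  fix e e' assume e: "e \<in> line_edges S" "e' \<in> line_edges S" and eq: "map_uprod f e = map_uprod f e'"
  show "e = e'"
  proof (rule uprod.inj_map_strong[OF _ eq])
    fix i j assume "i \<in> set_uprod e" "j \<in> set_uprod e'" "f i = f j"
    then show "i = j" using e set_uprod_line_edges assms by (meson inj_onD subsetD)
  qed
qed

text \<open>Edges of a line have multiplicity one, so an injective map carries one edge multiset to
  the other just when it preserves and reflects adjacency.\<close>

lemma graph_iso_line:
  assumes "finite S" "finite T"
  shows "graph_iso (line S) (line T) \<longleftrightarrow> line_iso S T"
proof -
  have "line T = map_graph f (line S) \<longleftrightarrow> f ` S = T \<and> (\<forall>i\<in>S. \<forall>j\<in>S. adj (f i) (f j) \<longleftrightarrow> adj i j)"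
    if f: "inj_on f S" for f
  proof -
    have e: "edges (map_graph f (line S)) = mset_set (map_uprod f ` line_edges S)"
      using assms f by (simp add: edges_line image_mset_mset_set inj_on_map_uprod)
    have "line T = map_graph f (line S) \<longleftrightarrow>
        T = f ` S \<and> mset_set (line_edges T) = mset_set (map_uprod f ` line_edges S)"
      using e assms edges_line[of T]
      by (metis multigraph.expand verts_line verts_map_graph)
    also have "mset_set (line_edges T) = mset_set (map_uprod f ` line_edges S) \<longleftrightarrow>
        line_edges T = map_uprod f ` line_edges S"
      using assms by (intro mset_set_eq_iff finite_imageI finite_line_edges)
    also have "T = f ` S \<and> line_edges T = map_uprod f ` line_edges S \<longleftrightarrow>
        f ` S = T \<and> (\<forall>i\<in>S. \<forall>j\<in>S. adj (f i) (f j) \<longleftrightarrow> adj i j)"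
    proof (intro conj_cong iffI)
      assume T: "f ` S = T" and E: "line_edges T = map_uprod f ` line_edges S"
      show "\<forall>i\<in>S. \<forall>j\<in>S. adj (f i) (f j) \<longleftrightarrow> adj i j"
      proof (intro ballI)
        fix i j assume ij: "i \<in> S" "j \<in> S"
        have "adj (f i) (f j) \<longleftrightarrow> Upair (f i) (f j) \<in> line_edges T"
          using ij T by (auto simp: Upair_in_line_edges)
        also have "\<dots> \<longleftrightarrow> (\<exists>i'\<in>S. \<exists>j'\<in>S. adj i' j' \<and> Upair (f i) (f j) = Upair (f i') (f j'))"
          unfolding E map_uprod_line_edges by blast
        also have "\<dots> \<longleftrightarrow> adj i j"
          using ij f by (auto simp: inj_on_def adj_def)
        finally show "adj (f i) (f j) \<longleftrightarrow> adj i j" .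
      qed
    next
      assume T: "f ` S = T" and E: "\<forall>i\<in>S. \<forall>j\<in>S. adj (f i) (f j) \<longleftrightarrow> adj i j"
      show "line_edges T = map_uprod f ` line_edges S"
        unfolding map_uprod_line_edges using E unfolding line_edges_def T[symmetric] by auto
    qed auto
    finally show ?thesis .
  qed
  then show ?thesis
    using assms finite_graph_line unfolding graph_iso_def line_iso_def bij_betw_def verts_line by metis
qed

section \<open>Calculus of isomorphisms between vertex sets of the line\<close>

lemma line_iso_refl: "line_iso S S"
  unfolding line_iso_def by (intro exI[of _ id]) auto

lemma line_iso_sym: "line_iso S T \<Longrightarrow> line_iso T S"
proof -
  assume "line_iso S T"
  then obtain f where f: "bij_betw f S T" "\<And>i j. i \<in> S \<Longrightarrow> j \<in> S \<Longrightarrow> adj (f i) (f j) \<longleftrightarrow> adj i j"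
    by (auto simp: line_iso_def)
  let ?g = "inv_into S f"
  have "bij_betw ?g T S" using f(1) by (rule bij_betw_inv_into)
  moreover have "adj (?g i) (?g j) \<longleftrightarrow> adj i j" if "i \<in> T" "j \<in> T" for i j
  proof -
    have "?g k \<in> S" "f (?g k) = k" if "k \<in> T" for k
      using f(1) that by (auto simp: bij_betw_def f_inv_into_f inv_into_into)
    then show ?thesis using f(2)[of "?g i" "?g j"] that by simp
  qed
  ultimately show ?thesis unfolding line_iso_def by blast
qed

lemma line_iso_trans: "line_iso S T \<Longrightarrow> line_iso T U \<Longrightarrow> line_iso S U"
proof -
  assume "line_iso S T" "line_iso T U"
  then obtain f g where fg: "bij_betw f S T" "\<And>i j. i \<in> S \<Longrightarrow> j \<in> S \<Longrightarrow> adj (f i) (f j) \<longleftrightarrow> adj i j"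
      "bij_betw g T U" "\<And>i j. i \<in> T \<Longrightarrow> j \<in> T \<Longrightarrow> adj (g i) (g j) \<longleftrightarrow> adj i j"
    by (auto simp: line_iso_def)
  then have "bij_betw (g \<circ> f) S U" by (auto intro: bij_betw_trans)
  moreover have "f i \<in> T" if "i \<in> S" for i using fg that by (auto simp: bij_betw_def)
  ultimately show ?thesis unfolding line_iso_def using fg by (intro exI[of _ "g \<circ> f"]) auto
qed

definition shift :: "nat \<Rightarrow> nat set \<Rightarrow> nat set" where
  "shift d S = (\<lambda>i. i + d) ` S"

lemma line_iso_shift: "line_iso S (shift d S)"
  unfolding line_iso_def shift_def
  by (intro exI[of _ "\<lambda>i. i + d"]) (auto simp: bij_betw_def inj_on_def adj_def)

definition apart :: "nat set \<Rightarrow> nat set \<Rightarrow> bool" where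
  "apart S T \<longleftrightarrow> (\<forall>i\<in>S. \<forall>j\<in>T. i \<noteq> j \<and> \<not> adj i j)"

lemma line_iso_Un:
  assumes "line_iso S S'" "line_iso T T'" "apart S T" "apart S' T'"
  shows "line_iso (S \<union> T) (S' \<union> T')"
proof -
  obtain f where f: "bij_betw f S S'" "\<And>i j. i \<in> S \<Longrightarrow> j \<in> S \<Longrightarrow> adj (f i) (f j) \<longleftrightarrow> adj i j"
    using assms(1) by (auto simp: line_iso_def)
  obtain g where g: "bij_betw g T T'" "\<And>i j. i \<in> T \<Longrightarrow> j \<in> T \<Longrightarrow> adj (g i) (g j) \<longleftrightarrow> adj i j"
    using assms(2) by (auto simp: line_iso_def)
  let ?h = "\<lambda>i. if i \<in> S then f i else g i"
  have disj: "i \<notin> S" if "i \<in> T" for i using that assms(3) by (auto simp: apart_def)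
  have adj_sym: "adj i j \<longleftrightarrow> adj j i" for i j by (auto simp: adj_def)
  have "bij_betw ?h S S'" using f(1) by (subst bij_betw_cong[of _ _ f]) auto
  moreover have "bij_betw ?h T T'" using g(1) disj by (subst bij_betw_cong[of _ _ g]) auto
  moreover have "S' \<inter> T' = {}" using assms(4) by (auto simp: apart_def)
  ultimately have "bij_betw ?h (S \<union> T) (S' \<union> T')" by (rule bij_betw_combine)
  moreover have "adj (?h i) (?h j) \<longleftrightarrow> adj i j" if ij: "i \<in> S \<union> T" "j \<in> S \<union> T" for i j
  proof -
    have fS: "f i \<in> S'" if "i \<in> S" for i using f(1) that by (auto simp: bij_betw_def)
    have gT: "g i \<in> T'" if "i \<in> T" for i using g(1) that by (auto simp: bij_betw_def)
    consider "i \<in> S" "j \<in> S" | "i \<in> T" "j \<in> T" | "i \<in> S" "j \<in> T" | "i \<in> T" "j \<in> S"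
      using ij by blast
    then show ?thesis
    proof cases
      case 3
      then have "\<not> adj i j" "\<not> adj (f i) (g j)" using assms(3,4) fS gT by (auto simp: apart_def)
      then show ?thesis using 3 disj by auto
    next
      case 4
      then have "\<not> adj j i" "\<not> adj (f j) (g i)" using assms(3,4) fS gT by (auto simp: apart_def)
      then show ?thesis using 4 disj adj_sym by auto
    qed (use f g disj in auto)
  qed
  ultimately show ?thesis unfolding line_iso_def by blast
qed

text \<open>Runs of vertices separated by single gaps; entries 0 are allowed and give longer gaps, so that
  every finite set is a layout.\<close>

fun layout :: "nat list \<Rightarrow> nat set" where
  "layout [] = {}"
| "layout (x # xs) = {..<x} \<union> shift (Suc x) (layout xs)"

lemma finite_layout [simp]: "finite (layout xs)"
  by (induction xs) (auto simp: shift_def)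

lemma apart_shift: "S \<subseteq> {..<x} \<Longrightarrow> apart S (shift (Suc x) T)"
  by (auto simp: apart_def shift_def adj_def)

lemma line_iso_shift_cong: "line_iso S T \<Longrightarrow> line_iso (shift d S) (shift d' T)"
  using line_iso_shift line_iso_sym line_iso_trans by blast

lemma layout_Cons_cong: "line_iso (layout xs) (layout ys) \<Longrightarrow> line_iso (layout (x # xs)) (layout (x # ys))"
  by (simp add: line_iso_Un line_iso_refl line_iso_shift_cong apart_shift)

text \<open>Two translations exchange the first two runs. Both orders occupy
  \<open>x + y + 2\<close> positions, gaps included, so the remaining runs stay in place.\<close>

lemma line_iso_layout_swap: "line_iso (layout (x # y # xs)) (layout (y # x # xs))"
proof -
  have split: "layout (x # y # xs) = ({..<x} \<union> shift (Suc x) {..<y}) \<union> shift (Suc (Suc x + y)) (layout xs)"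
    for x y by (auto simp: shift_def image_Un image_image add_ac)
  have "line_iso ({..<x} \<union> shift (Suc x) {..<y}) (shift (Suc y) {..<x} \<union> {..<y})"
  proof (rule line_iso_Un)
    show "line_iso {..<x} (shift (Suc y) {..<x})" by (rule line_iso_shift)
    show "line_iso (shift (Suc x) {..<y}) {..<y}" by (rule line_iso_sym[OF line_iso_shift])
    show "apart {..<x} (shift (Suc x) {..<y})" by (simp add: apart_shift)
    have "apart {..<y} (shift (Suc y) {..<x})" by (simp add: apart_shift)
    then show "apart (shift (Suc y) {..<x}) {..<y}" by (auto simp: apart_def adj_def)
  qed
  then have "line_iso ({..<x} \<union> shift (Suc x) {..<y}) ({..<y} \<union> shift (Suc y) {..<x})"
    by (simp add: Un_commute)
  then show ?thesis unfolding split
    by (rule line_iso_Un[OF _ line_iso_shift_cong[OF line_iso_refl]];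
        intro apart_shift) (auto simp: shift_def)
qed

lemma line_iso_layout_move: "line_iso (layout (us @ x # vs)) (layout (x # us @ vs))"
proof (induction us)
  case (Cons u us)
  have "line_iso (layout (u # us @ x # vs)) (layout (u # x # us @ vs))"
    using Cons layout_Cons_cong by blast
  then show ?case using line_iso_layout_swap line_iso_trans by (metis append_Cons)
qed (simp add: line_iso_refl)

lemma line_iso_layout_mset: "mset xs = mset ys \<Longrightarrow> line_iso (layout xs) (layout ys)"
proof (induction xs arbitrary: ys)
  case (Cons x xs)
  then have "x \<in> set ys" by (metis list.set_intros(1) set_mset_mset)
  then obtain us vs where ys: "ys = us @ x # vs" by (meson split_list)
  then have "line_iso (layout xs) (layout (us @ vs))" using Cons by simp
  then have "line_iso (layout (x # xs)) (layout (x # us @ vs))" by (rule layout_Cons_cong)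
  then show ?case using line_iso_layout_move line_iso_sym line_iso_trans ys by blast
qed (simp add: line_iso_refl)

lemma line_iso_layout_filter: "line_iso (layout xs) (layout (filter (\<lambda>x. x \<noteq> 0) xs))"
proof (induction xs)
  case (Cons x xs)
  show ?case
  proof (cases "x = 0")
    case True
    then have "line_iso (layout (x # xs)) (layout xs)"
      using line_iso_sym[OF line_iso_shift[of "layout xs" "Suc 0"]] by simp
    then show ?thesis using line_iso_trans[OF _ Cons] True by simp
  next
    case False
    then show ?thesis using layout_Cons_cong[OF Cons] by simp
  qed
qed (simp add: line_iso_refl)

text \<open>The smallest missing vertex ends the first run, possibly of length 0; the vertices
  beyond it form a smaller instance.\<close>

lemma ex_layout:
  assumes "S \<subseteq> {..<m}"
  shows "\<exists>xs. S = layout xs \<and> sum_list xs + length xs \<le> Suc m"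
  using assms
proof (induction m arbitrary: S rule: less_induct)
  case (less m)
  show ?case
  proof (cases "S = {}")
    case True
    then show ?thesis by (intro exI[of _ "[]"]) simp
  next
    case False
    have "m \<notin> S" using less.prems by auto
    define x where "x = (LEAST i. i \<notin> S)"
    have x: "x \<notin> S" "x \<le> m" unfolding x_def using LeastI[of "\<lambda>i. i \<notin> S" m] Least_le[of "\<lambda>i. i \<notin> S" m] \<open>m \<notin> S\<close> by auto
    have below: "i \<in> S" if "i < x" for i using that not_less_Least unfolding x_def by blast
    define R where "R = {j. j + Suc x \<in> S}"
    have S: "S = {..<x} \<union> shift (Suc x) R"
    proof (intro set_eqI iffI)
      fix i assume i: "i \<in> S"
      then have "i \<noteq> x" using x by auto
      then consider "i < x" | "i - Suc x + Suc x = i" by linarith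
      then show "i \<in> {..<x} \<union> shift (Suc x) R"
      proof cases
        case 2
        then have "i - Suc x \<in> R" using i unfolding R_def by simp
        then show ?thesis using 2 unfolding shift_def by (metis UnI2 imageI)
      qed simp
    qed (auto simp: R_def shift_def below)
    \<comment> \<open>If nothing follows the gap, the list must end here: for \<open>x = m\<close> a
      further entry would break the length bound.\<close>
    show ?thesis
    proof (cases "R = {}")
      case True
      then show ?thesis using S x by (intro exI[of _ "[x]"]) (simp add: shift_def)
    next
      case False
      then have "x < m" using less.prems by (auto simp: R_def)
      have "R \<subseteq> {..<m - Suc x}" using less.prems by (auto simp: R_def)
      then obtain xs where "R = layout xs" "sum_list xs + length xs \<le> Suc (m - Suc x)"
        using less.IH[of "m - Suc x" R] \<open>x < m\<close> by auto
      then show ?thesis using S \<open>x < m\<close> by (intro exI[of _ "x # xs"]) auto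
    qed
  qed
qed

lemma layout_subset: "sum_list xs + length xs \<le> Suc m \<Longrightarrow> layout xs \<subseteq> {..<m}"
proof (induction xs arbitrary: m)
  case (Cons x xs)
  show ?case
  proof (cases xs)
    case Nil
    then show ?thesis using Cons.prems by (auto simp: shift_def)
  next
    case (Cons y ys)
    then have "layout xs \<subseteq> {..<m - Suc x}" using Cons.prems Cons.IH[of "m - Suc x"] by simp
    then show ?thesis using Cons.prems by (auto simp: shift_def)
  qed
qed simp

text \<open>The size of the gap between the two blocks is immaterial as long as they do not touch,
  so the tight position can be exchanged for any later one.\<close>

lemma layout_append_iso:
  assumes "layout xs \<subseteq> {..<m}"
  shows "line_iso (layout (xs @ ys)) (layout xs \<union> shift (Suc m) (layout ys))"
proof -
  have "line_iso (layout (xs @ ys)) (layout xs \<union> shift (sum_list xs + length xs) (layout ys))"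
    for xs
  proof (induction xs)
    case (Cons x xs)
    have "layout (x # xs) \<union> shift (sum_list (x # xs) + length (x # xs)) (layout ys) =
      {..<x} \<union> shift (Suc x) (layout xs \<union> shift (sum_list xs + length xs) (layout ys))"
      by (auto simp: shift_def image_Un image_image add_ac)
    then show ?case using Cons
      by (simp add: line_iso_Un line_iso_refl line_iso_shift_cong apart_shift)
  qed (simp add: shift_def line_iso_refl)
  moreover have "apart (layout xs) (shift (sum_list xs + length xs) (layout ys))"
  proof (cases xs)
    case (Cons x xs')
    then obtain k where k: "sum_list xs + length xs = Suc k" by simp
    then show ?thesis using layout_subset[of xs k] apart_shift by simp
  qed (simp add: apart_def)
  ultimately show ?thesis
    using assms apart_shift[OF assms] line_iso_trans line_iso_Un[OF line_iso_refl line_iso_shift_cong[OF line_iso_refl]]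
    by blast
qed

text \<open>The number of windows of each length is an isomorphism invariant that determines the multiset
  of run lengths.\<close>

definition windows :: "nat \<Rightarrow> nat set \<Rightarrow> nat set" where
  "windows k S = {i. {i..<i + k} \<subseteq> S}"

lemma finite_windows:
  assumes "finite S" "0 < k"
  shows "finite (windows k S)"
  by (rule finite_subset[OF _ assms(1)]) (use assms(2) in \<open>auto simp: windows_def\<close>)

text \<open>No window contains the gap at \<open>x\<close>, so it lies inside the first run or
  entirely beyond.\<close>

lemma windows_layout_Cons:
  assumes "0 < k"
  shows "windows k (layout (x # xs)) = {i. i + k \<le> x} \<union> shift (Suc x) (windows k (layout xs))"
proof (intro set_eqI iffI)
  fix i assume i: "i \<in> windows k (layout (x # xs))"
  have x: "x \<notin> layout (x # xs)" by (auto simp: shift_def)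
  have "i + k \<le> x \<or> x < i"
  proof (rule ccontr)
    assume "\<not> (i + k \<le> x \<or> x < i)"
    then have "x \<in> {i..<i + k}" by auto
    then show False using i x by (auto simp: windows_def)
  qed
  then show "i \<in> {i. i + k \<le> x} \<union> shift (Suc x) (windows k (layout xs))"
  proof
    assume "x < i"
    define j where "j = i - Suc x"
    have j: "i = j + Suc x" using \<open>x < i\<close> by (simp add: j_def)
    have "j \<in> windows k (layout xs)"
      unfolding windows_def
    proof (intro CollectI subsetI)
      fix l assume "l \<in> {j..<j + k}"
      then have "l + Suc x \<in> {i..<i + k}" using j by auto
      then have "l + Suc x \<in> layout (x # xs)" using i unfolding windows_def by blast
      then show "l \<in> layout xs" by (auto simp: shift_def)
    qed
    then show ?thesis using j by (auto simp: shift_def)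
  qed simp
next
  fix i assume "i \<in> {i. i + k \<le> x} \<union> shift (Suc x) (windows k (layout xs))"
  then consider "i + k \<le> x" | j where "i = j + Suc x" "{j..<j + k} \<subseteq> layout xs"
    by (auto simp: shift_def windows_def)
  then show "i \<in> windows k (layout (x # xs))"
  proof cases
    case 1
    then show ?thesis by (auto simp: windows_def)
  next
    case 2
    have "l \<in> layout (x # xs)" if "l \<in> {i..<i + k}" for l
    proof -
      have "l - Suc x \<in> {j..<j + k}" and l: "l = (l - Suc x) + Suc x" using that 2(1) by auto
      then have "l - Suc x \<in> layout xs" using 2(2) by blast
      with l show ?thesis unfolding layout.simps shift_def by blast
    qed
    then show ?thesis unfolding windows_def by blast
  qed
qed

lemma card_windows_layout:
  assumes "0 < k"
  shows "card (windows k (layout xs)) = (\<Sum>x\<in>#mset xs. Suc x - k)"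
proof (induction xs)
  case Nil
  then show ?case using assms by (simp add: windows_def)
next
  case (Cons x xs)
  have eq: "{i. i + k \<le> x} = {..<Suc x - k}" using assms by auto
  have "{..<Suc x - k} \<inter> shift (Suc x) (windows k (layout xs)) = {}" by (auto simp: shift_def)
  then have "card (windows k (layout (x # xs))) =
      (Suc x - k) + card (shift (Suc x) (windows k (layout xs)))"
    unfolding windows_layout_Cons[OF assms] eq using assms
    by (subst card_Un_disjoint) (auto simp: finite_windows shift_def)
  also have "card (shift (Suc x) (windows k (layout xs))) = card (windows k (layout xs))"
    unfolding shift_def by (rule card_image) (simp add: inj_on_def)
  finally show ?case using Cons by simp
qed

text \<open>An injective walk on a path cannot turn back. The descending case is written additively
  to avoid truncated subtraction.\<close>

lemma walk_monotone:
  fixes a :: "nat \<Rightarrow> nat"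
  assumes "\<And>t. Suc t < k \<Longrightarrow> adj (a t) (a (Suc t))" "inj_on a {..<k}"
  shows "(\<forall>t<k. a t = a 0 + t) \<or> (\<forall>t<k. a t + t = a 0)"
  using assms
proof (induction k)
  case (Suc k)
  have "inj_on a {..<k}" using Suc.prems(2) by (rule inj_on_subset) auto
  then have IH: "(\<forall>t<k. a t = a 0 + t) \<or> (\<forall>t<k. a t + t = a 0)" using Suc by simp
  consider "k = 0" | "k = 1" | l where "k = Suc (Suc l)" by (metis One_nat_def not0_implies_Suc)
  then show ?case
  proof cases
    case 2
    then have "adj (a 0) (a 1)" using Suc.prems(1)[of 0] by simp
    then show ?thesis using 2 by (auto simp: adj_def less_Suc_eq)
  next
    case 3
    have adj: "adj (a (Suc l)) (a k)" using Suc.prems(1)[of "Suc l"] 3 by simp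
    have ne: "a k \<noteq> a l" using inj_onD[OF Suc.prems(2), of k l] 3 by auto
    show ?thesis
      using IH
    proof
      assume up: "\<forall>t<k. a t = a 0 + t"
      have "a (Suc l) = a 0 + Suc l" "a l = a 0 + l" using up[rule_format, of "Suc l"] up[rule_format, of l] 3 by simp_all
      then have "a k = a 0 + k" using adj ne 3 unfolding adj_def by linarith
      then show ?thesis using up by (metis less_Suc_eq)
    next
      assume down: "\<forall>t<k. a t + t = a 0"
      have "a (Suc l) + Suc l = a 0" "a l + l = a 0" using down[rule_format, of "Suc l"] down[rule_format, of l] 3 by simp_all
      then have "a k + k = a 0" using adj ne 3 unfolding adj_def by linarith
      then show ?thesis using down by (metis less_Suc_eq)
    qed
  qed simp
qed simp

text \<open>Along the window \<open>f\<close> is an injective walk, hence straight by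
  \<open>walk_monotone\<close>, although possibly reversed.\<close>

lemma image_window:
  assumes "inj_on f S" "\<And>i j. i \<in> S \<Longrightarrow> j \<in> S \<Longrightarrow> adj (f i) (f j) \<longleftrightarrow> adj i j"
    and "{i..<i + k} \<subseteq> S"
  shows "\<exists>j. f ` {i..<i + k} = {j..<j + k}"
proof -
  define a where "a t = f (i + t)" for t
  have iS: "i + t \<in> S" if "t < k" for t using that assms(3) by auto
  have "adj (a t) (a (Suc t))" if "Suc t < k" for t
  proof -
    have "i + t \<in> S" "i + Suc t \<in> S" using iS[of t] iS[of "Suc t"] that by simp_all
    moreover have "adj (i + t) (i + Suc t)" by (simp add: adj_def)
    ultimately show ?thesis using assms(2) by (simp add: a_def)
  qed
  moreover have "inj_on a {..<k}"
    using iS inj_onD[OF assms(1)] by (fastforce simp: inj_on_def a_def)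
  ultimately have walk: "(\<forall>t<k. a t = a 0 + t) \<or> (\<forall>t<k. a t + t = a 0)"
    by (rule walk_monotone)
  have interval: "(\<lambda>t. b + t) ` {..<k} = {b..<b + k}" for b :: nat
    by (metis add_0 add.commute image_add_atLeastLessThan lessThan_atLeast0)
  have img: "f ` {i..<i + k} = a ` {..<k}"
    unfolding interval[of i, symmetric] by (simp add: image_image a_def)
  show ?thesis
    using walk
  proof
    assume up: "\<forall>t<k. a t = a 0 + t"
    have "a ` {..<k} = (\<lambda>t. a 0 + t) ` {..<k}" by (rule image_cong[OF refl]) (use up in blast)
    then show ?thesis using img interval by metis
  next
    assume down: "\<forall>t<k. a t + t = a 0"
    show ?thesis
    proof (cases k)
      case (Suc l)
      have eq: "a t = a l + (l - t)" if "t < k" for t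
      proof -
        have "a t + t = a 0" "a l + l = a 0" "t \<le> l"
          using down[rule_format, of t] down[rule_format, of l] that Suc by simp_all
        then show ?thesis by linarith
      qed
      have "a ` {..<k} = {a l..<a l + k}"
      proof (intro set_eqI iffI)
        fix y assume "y \<in> a ` {..<k}"
        then obtain t where "t < k" "y = a t" by blast
        then have "y = a l + (l - t)" using eq[of t] by linarith
        then show "y \<in> {a l..<a l + k}" using Suc by simp
      next
        fix y assume y: "y \<in> {a l..<a l + k}"
        define t where "t = l - (y - a l)"
        have "t < k" using Suc by (simp add: t_def)
        moreover have "y = a l + (l - t)" using y Suc by (auto simp: t_def)
        then have "y = a t" using eq[OF \<open>t < k\<close>] by linarith
        ultimately show "y \<in> a ` {..<k}" by blast
      qed
      then show ?thesis using img by metis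
    qed simp
  qed
qed

text \<open>Windows are compared as vertex sets rather than by their left ends, because
  \<open>f\<close> may reverse some of them.\<close>

lemma card_windows_le:
  assumes "line_iso S T" "finite T" "0 < k"
  shows "card (windows k S) \<le> card (windows k T)"
proof -
  obtain f where f: "bij_betw f S T" "\<And>i j. i \<in> S \<Longrightarrow> j \<in> S \<Longrightarrow> adj (f i) (f j) \<longleftrightarrow> adj i j"
    using assms(1) by (auto simp: line_iso_def)
  then have inj: "inj_on f S" "f ` S = T" by (auto simp: bij_betw_def)
  let ?I = "\<lambda>i. {i..<i + k}"
  have injI: "inj_on ?I A" for A
  proof (rule inj_onI)
    fix i j :: nat assume "?I i = ?I j"
    moreover have "i \<in> ?I i" "j \<in> ?I j" using assms(3) by auto
    ultimately show "i = j" by (metis atLeastLessThan_iff le_antisym)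
  qed
  have "card (windows k S) = card (?I ` windows k S)" by (rule card_image[OF injI, symmetric])
  also have "\<dots> = card ((\<lambda>W. f ` W) ` ?I ` windows k S)"
  proof (rule card_image[symmetric])
    show "inj_on ((`) f) (?I ` windows k S)"
      by (rule inj_on_subset[OF inj_on_image_Pow[OF inj(1)]]) (auto simp: windows_def)
  qed
  also have "\<dots> \<le> card (?I ` windows k T)"
  proof (rule card_mono)
    show "finite (?I ` windows k T)" using assms finite_windows by blast
    show "(\<lambda>W. f ` W) ` ?I ` windows k S \<subseteq> ?I ` windows k T"
    proof
      fix W assume "W \<in> (\<lambda>W. f ` W) ` ?I ` windows k S"
      then obtain i where i: "W = f ` ?I i" "?I i \<subseteq> S" by (auto simp: windows_def)
      then obtain j where "W = ?I j" using image_window[OF inj(1) f(2) i(2)] by auto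
      moreover have "W \<subseteq> T" using i inj by auto
      ultimately show "W \<in> ?I ` windows k T" by (auto simp: windows_def)
    qed
  qed
  also have "\<dots> = card (windows k T)" by (rule card_image[OF injI])
  finally show ?thesis .
qed

lemma card_windows_iso:
  "line_iso S T \<Longrightarrow> finite S \<Longrightarrow> finite T \<Longrightarrow> 0 < k \<Longrightarrow> card (windows k S) = card (windows k T)"
  by (simp add: card_windows_le le_antisym line_iso_sym)

text \<open>The second difference in \<open>k\<close> of the truncated \<open>Suc x - k\<close> is 1
  for \<open>x = k\<close> and 0 otherwise, so window counts recover multiplicities.\<close>

lemma count_second_difference:
  "0 < k \<Longrightarrow> count M k + 2 * (\<Sum>x\<in>#M. Suc x - Suc k) = (\<Sum>x\<in>#M. Suc x - k) + (\<Sum>x\<in>#M. Suc x - Suc (Suc k))"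
  by (induction M) auto

lemma line_iso_layout_imp_mset_eq:
  assumes "line_iso (layout xs) (layout ys)" "0 \<notin> set xs" "0 \<notin> set ys"
  shows "mset xs = mset ys"
proof (rule multiset_eqI)
  fix k
  have *: "(\<Sum>x\<in>#mset xs. Suc x - l) = (\<Sum>x\<in>#mset ys. Suc x - l)" if "0 < l" for l
    using card_windows_iso[OF assms(1) _ _ that] card_windows_layout[OF that] by simp
  show "count (mset xs) k = count (mset ys) k"
  proof (cases "k = 0")
    case True
    then show ?thesis using assms by (metis count_eq_zero_iff set_mset_mset)
  next
    case False
    then show ?thesis
      using count_second_difference[of k "mset xs"] count_second_difference[of k "mset ys"]
        *[of k] *[of "Suc k"] *[of "Suc (Suc k)"] by simp
  qed
qed

section \<open>Subforests and packings\<close>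

text \<open>The vertices of \<open>W\<close> in the first run form one load by
  \<open>ex_layout\<close>, after dropping zero entries; the rest is handled by induction.\<close>

lemma packs_of_subset_layout:
  assumes "W \<subseteq> layout xs"
  shows "\<exists>ys. packs (mset ys) (mset xs) \<and> line_iso W (layout ys)"
  using assms
proof (induction xs arbitrary: W)
  case Nil
  then show ?case by (intro exI[of _ "[]"]) (simp add: line_iso_refl)
next
  case (Cons x xs)
  define V where "V = {j. j + Suc x \<in> W}"
  have W: "W = (W \<inter> {..<x}) \<union> shift (Suc x) V"
    using Cons.prems by (auto simp: V_def shift_def)
  have "V \<subseteq> layout xs" using Cons.prems by (auto simp: V_def shift_def)
  then obtain ys where ys: "packs (mset ys) (mset xs)" "line_iso V (layout ys)"
    using Cons.IH by blast
  obtain zs where zs: "W \<inter> {..<x} = layout zs" "sum_list zs + length zs \<le> Suc x"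
    using ex_layout[of "W \<inter> {..<x}" x] by auto
  then have sub: "layout zs \<subseteq> {..<x}" by auto
  let ?zs = "filter (\<lambda>z. z \<noteq> 0) zs"
  have "line_iso W (layout zs \<union> shift (Suc x) (layout ys))"
    unfolding zs(1)[symmetric]
    by (subst W) (intro line_iso_Un line_iso_refl line_iso_shift_cong ys(2) apart_shift; simp)
  then have "line_iso W (layout (zs @ ys))"
    using layout_append_iso[OF sub] line_iso_sym line_iso_trans by blast
  then have 1: "line_iso W (layout (filter (\<lambda>z. z \<noteq> 0) (zs @ ys)))"
    using line_iso_layout_filter line_iso_trans by blast
  have "0 \<notin> set ys" using packs_pos[OF ys(1)] by simp
  then have "filter (\<lambda>z. z \<noteq> 0) ys = ys" by (intro filter_True) metis
  then have 2: "line_iso W (layout (?zs @ ys))" using 1 by simp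
  have "sum_list ?zs = sum_list zs" by (induction zs) auto
  moreover have "length ?zs \<le> length zs" by simp
  ultimately have "sum_mset (mset ?zs) + size (mset ?zs) \<le> Suc x"
    unfolding sum_mset_sum_list size_mset using zs(2) by linarith
  then have "fits (mset ?zs) x" by (simp add: fits_def)
  then have "packs (mset ys + mset ?zs) (mset (x # xs))"
    using packs_add_msetI[OF ys(1)] by simp
  then show ?case using 2 by (intro exI[of _ "?zs @ ys"]) (simp add: add.commute)
qed

text \<open>The load of each bin is laid out inside the corresponding run, where
  \<open>layout_subset\<close> guarantees enough space.\<close>

lemma subset_layout_of_packs:
  assumes "packs N (mset xs)"
  shows "\<exists>W ys. W \<subseteq> layout xs \<and> mset ys = N \<and> line_iso W (layout ys)"
  using assms
proof (induction xs arbitrary: N)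
  case Nil
  then show ?case by (intro exI[of _ "{}"] exI[of _ "[]"]) (simp add: line_iso_refl)
next
  case (Cons x xs)
  then obtain K N' where K: "N = N' + K" "fits K x" "packs N' (mset xs)"
    by (auto elim: packs_add_msetE)
  obtain V ys where V: "V \<subseteq> layout xs" "mset ys = N'" "line_iso V (layout ys)"
    using Cons.IH[OF K(3)] by blast
  obtain zs where zs: "mset zs = K" by (metis ex_mset)
  have "sum_list zs + length zs \<le> Suc x"
    using K(2) unfolding zs[symmetric] by (simp add: fits_def sum_mset_sum_list)
  then have sub: "layout zs \<subseteq> {..<x}" by (rule layout_subset)
  have "line_iso (layout zs \<union> shift (Suc x) V) (layout zs \<union> shift (Suc x) (layout ys))"
    by (intro line_iso_Un line_iso_refl line_iso_shift_cong V(3) apart_shift sub)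
  then have "line_iso (layout zs \<union> shift (Suc x) V) (layout (zs @ ys))"
    using layout_append_iso[OF sub] line_iso_sym line_iso_trans by blast
  moreover have "layout zs \<union> shift (Suc x) V \<subseteq> layout (x # xs)"
    using sub V(1) by (auto simp: shift_def)
  moreover have "mset (zs @ ys) = N" using zs V K by simp
  ultimately show ?case by blast
qed

definition forest :: "nat multiset \<Rightarrow> unlabelled_graph" where
  "forest M = abs_unlabelled_graph (line (layout (sorted_list_of_multiset M)))"

lemma abs_line_eq_iff:
  assumes "finite S" "finite T"
  shows "abs_unlabelled_graph (line S) = abs_unlabelled_graph (line T) \<longleftrightarrow> line_iso S T"
proof -
  have "graph_iso (line S) (line S)" "graph_iso (line T) (line T)"
    using assms by (simp_all add: graph_iso_refl finite_graph_line)
  then show ?thesis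
    using Quotient_rel[OF Quotient_unlabelled_graph, of "line S" "line T"] graph_iso_line[OF assms] by simp
qed

lemma forest_mset: "forest (mset xs) = abs_unlabelled_graph (line (layout xs))"
  unfolding forest_def by (subst abs_line_eq_iff) (auto intro!: line_iso_layout_mset)

lemma le_abs_line_iff:
  assumes "finite S"
  shows "c \<le> abs_unlabelled_graph (line S) \<longleftrightarrow> (\<exists>W\<subseteq>S. c = abs_unlabelled_graph (line W))"
proof -
  let ?r = "rep_unlabelled_graph c"
  have r: "graph_iso ?r ?r" by (rule Quotient_rep_reflp[OF Quotient_unlabelled_graph])
  have c: "c = abs_unlabelled_graph ?r" by (rule Quotient_abs_rep[OF Quotient_unlabelled_graph, symmetric])
  have l: "graph_iso (line S) (line S)" using assms by (simp add: graph_iso_refl finite_graph_line)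
  have "c \<le> abs_unlabelled_graph (line S) \<longleftrightarrow> induced_subgraph_of ?r (line S)"
    by (subst c) (rule less_eq_unlabelled_graph.abs_eq[OF r l])
  also have "\<dots> \<longleftrightarrow> (\<exists>W\<subseteq>S. graph_iso ?r (line W))"
    using assms by (auto simp: induced_subgraph_of_def induce_line)
  also have "\<dots> \<longleftrightarrow> (\<exists>W\<subseteq>S. c = abs_unlabelled_graph (line W))"
  proof -
    have "graph_iso ?r (line W) \<longleftrightarrow> c = abs_unlabelled_graph (line W)" if "W \<subseteq> S" for W
      using Quotient_rel[OF Quotient_unlabelled_graph, of ?r "line W"] r c that assms finite_subset
        graph_iso_refl finite_graph_line by metis
    then show ?thesis by blast
  qed
  finally show ?thesis .
qed

lemma le_forest_iff: "c \<le> forest M \<longleftrightarrow> (\<exists>N. packs N M \<and> c = forest N)"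
proof -
  obtain xs where xs: "M = mset xs" by (metis ex_mset)
  have eq: "abs_unlabelled_graph (line W) = forest (mset ys)"
    if "W \<subseteq> layout xs" "line_iso W (layout ys)" for W ys
    using that finite_subset[OF that(1)] by (simp add: forest_mset abs_line_eq_iff)
  show ?thesis
  proof
    assume "c \<le> forest M"
    then obtain W where W: "W \<subseteq> layout xs" "c = abs_unlabelled_graph (line W)"
      unfolding xs forest_mset le_abs_line_iff[OF finite_layout] by blast
    then obtain ys where "packs (mset ys) (mset xs)" "line_iso W (layout ys)"
      using packs_of_subset_layout by blast
    then show "\<exists>N. packs N M \<and> c = forest N" using W eq xs by blast
  next
    assume "\<exists>N. packs N M \<and> c = forest N"
    then obtain N where N: "packs N (mset xs)" "c = forest N" using xs by blast
    obtain W ys where W: "W \<subseteq> layout xs" "mset ys = N" "line_iso W (layout ys)"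
      using subset_layout_of_packs[OF N(1)] by blast
    then have "c = abs_unlabelled_graph (line W)" using eq[OF W(1,3)] N(2) by simp
    then show "c \<le> forest M"
      unfolding xs forest_mset le_abs_line_iff[OF finite_layout] using W(1) by blast
  qed
qed

lemma forest_inject:
  assumes "0 \<notin># M" "0 \<notin># N" "forest M = forest N"
  shows "M = N"
proof -
  let ?l = sorted_list_of_multiset
  have "line_iso (layout (?l M)) (layout (?l N))" using assms(3) by (simp add: forest_def abs_line_eq_iff)
  then have "mset (?l M) = mset (?l N)" using assms by (intro line_iso_layout_imp_mset_eq) auto
  then show ?thesis by simp
qed

text \<open>Positions come in blocks of length \<open>Suc x\<close>; the last position of each block
  is the gap.\<close>

lemma layout_replicate: "layout (replicate n x) = {i. i div Suc x < n \<and> i mod Suc x < x}"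
proof (induction n)
  case (Suc n)
  show ?case
  proof (intro set_eqI)
    fix i
    show "i \<in> layout (replicate (Suc n) x) \<longleftrightarrow> i \<in> {i. i div Suc x < Suc n \<and> i mod Suc x < x}"
    proof (cases "i < Suc x")
      case True
      then show ?thesis by (auto simp: shift_def)
    next
      case False
      define j where "j = i - Suc x"
      have i: "i = j + Suc x" using False by (simp add: j_def)
      have "i div Suc x = Suc (j div Suc x)" "i mod Suc x = j mod Suc x"
        unfolding i using div_add_self2[of "Suc x" j] mod_add_self2[of j "Suc x"] by simp_all
      moreover have "i \<in> layout (replicate (Suc n) x) \<longleftrightarrow> j \<in> layout (replicate n x)"
        unfolding i by (auto simp: shift_def)
      ultimately show ?thesis unfolding Suc.IH by simp
    qed
  qed
qed simp

text \<open>Vertex \<open>v\<close> of copy \<open>k\<close> goes to position \<open>v\<close> of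
  block \<open>k\<close>. Division with remainder by \<open>Suc x\<close> inverts this map.\<close>

lemma graph_iso_copies_path:
  "graph_iso (disjoint_copies n (path x)) (line (layout (replicate n x)))"
proof -
  let ?f = "\<lambda>m. case prod_decode m of (k, v) \<Rightarrow> k * Suc x + v"
  let ?G = "disjoint_copies n (path x)"
  let ?S = "layout (replicate n x)"
  have dm: "(k * Suc x + v) div Suc x = k" "(k * Suc x + v) mod Suc x = v" if "v \<le> x" for k v
    using that div_mult_self3[of "Suc x" k v] mod_mult_self3[of k "Suc x" v] by simp_all
  have mem: "k * Suc x + v \<in> ?S \<longleftrightarrow> k < n \<and> v < x" if "v \<le> x" for k v
    using dm[OF that] by (simp add: layout_replicate)
  have inj: "inj_on ?f (verts ?G)"
  proof (rule inj_onI)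
    fix a b assume "a \<in> verts ?G" "b \<in> verts ?G" and eq: "?f a = ?f b"
    then obtain k v l u where a: "a = prod_encode (k, v)" "v < x" and b: "b = prod_encode (l, u)" "u < x"
      by (auto simp: disjoint_copies_def path_def)
    have "k * Suc x + v = l * Suc x + u" using eq a b by simp
    then have "k = l" "v = u" using dm[of v k] dm[of u l] a b by (metis less_imp_le)+
    then show "a = b" using a b by simp
  qed
  have S_repr: "\<exists>k v. i = k * Suc x + v \<and> k < n \<and> v < x" if "i \<in> ?S" for i
  proof (intro exI conjI)
    show "i = i div Suc x * Suc x + i mod Suc x" by (rule div_mult_mod_eq[symmetric])
  qed (use that in \<open>simp_all add: layout_replicate\<close>)
  have verts: "?f ` verts ?G = ?S"
  proof -
    have "?f ` verts ?G = (\<Union>k<n. (\<lambda>v. k * Suc x + v) ` {..<x})"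
      by (simp add: disjoint_copies_def path_def image_UN image_image)
    also have "\<dots> = ?S"
    proof (intro set_eqI iffI)
      fix i assume "i \<in> (\<Union>k<n. (\<lambda>v. k * Suc x + v) ` {..<x})"
      then show "i \<in> ?S" using mem by auto
    next
      fix i assume "i \<in> ?S"
      then show "i \<in> (\<Union>k<n. (\<lambda>v. k * Suc x + v) ` {..<x})" using S_repr by blast
    qed
    finally show ?thesis .
  qed
  let ?A = "\<lambda>k. (\<lambda>i. k * Suc x + i) ` {i. Suc i < x}"
  have finA: "finite {i. Suc i < x}" by (rule finite_subset[of _ "{..<x}"]) auto
  have image_sum: "image_mset h (\<Sum>k<m. M k) = (\<Sum>k<m. image_mset h (M k))"
    for h :: "'a \<Rightarrow> 'b" and M :: "nat \<Rightarrow> 'a multiset" and m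
    by (induction m) auto
  have disj: "?A k \<inter> ?A l = {}" if "k \<noteq> l" for k l
  proof (rule ccontr)
    assume "?A k \<inter> ?A l \<noteq> {}"
    then obtain i j where "k * Suc x + i = l * Suc x + j" "Suc i < x" "Suc j < x" by blast
    then show False using dm(1)[of i k] dm(1)[of j l] that by simp
  qed
  have "edges (map_graph ?f ?G) =
      (\<Sum>k<n. image_mset (\<lambda>i. Upair i (Suc i)) (image_mset (\<lambda>i. k * Suc x + i) (mset_set {i. Suc i < x})))"
    by (simp add: disjoint_copies_def path_def image_sum multiset.map_comp comp_def)
  also have "\<dots> = (\<Sum>k<n. image_mset (\<lambda>i. Upair i (Suc i)) (mset_set (?A k)))"
    by (simp add: image_mset_mset_set inj_on_def)
  also have "\<dots> = image_mset (\<lambda>i. Upair i (Suc i)) (\<Sum>k<n. mset_set (?A k))"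
    by (simp add: image_sum)
  \<comment> \<open>The left ends of edges in different copies are distinct, so the sum of multisets
    has no repetitions.\<close>
  also have "(\<Sum>k<m. mset_set (?A k)) = mset_set (\<Union>k<m. ?A k)" for m
  proof (induction m)
    case (Suc m)
    have "?A m \<inter> ?A k = {}" if "k < m" for k using that by (intro disj) simp
    then have "?A m \<inter> (\<Union>k<m. ?A k) = {}" by (simp add: Int_UN_distrib del: mult_Suc_right)
    then have "mset_set (?A m \<union> (\<Union>k<m. ?A k)) = mset_set (?A m) + mset_set (\<Union>k<m. ?A k)"
      using finA by (intro mset_set_Union) auto
    then show ?case using Suc by (simp add: lessThan_Suc add.commute)
  qed simp
  also have "(\<Union>k<n. ?A k) = {i. i \<in> ?S \<and> Suc i \<in> ?S}"
  proof (intro set_eqI iffI)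
    fix i assume "i \<in> (\<Union>k<n. ?A k)"
    then obtain k v where "k < n" "Suc v < x" "i = k * Suc x + v" by auto
    then show "i \<in> {i. i \<in> ?S \<and> Suc i \<in> ?S}" using mem[of v k] mem[of "Suc v" k] by simp
  next
    fix i assume i: "i \<in> {i. i \<in> ?S \<and> Suc i \<in> ?S}"
    then obtain k v where kv: "i = k * Suc x + v" "k < n" "v < x" using S_repr by blast
    then have "Suc v < x" using i mem[of "Suc v" k] by simp
    then show "i \<in> (\<Union>k<n. ?A k)" using kv by blast
  qed
  finally have "edges (map_graph ?f ?G) = edges (line ?S)" by (simp add: line_def)
  then have eq: "line ?S = map_graph ?f ?G"
    using verts by (intro multigraph.expand) simp
  show ?thesis
    unfolding graph_iso_def
  proof (intro conjI exI)
    show "finite_graph ?G" by (intro finite_graph_copies finite_graph_path)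
    show "finite_graph (line ?S)" by (simp add: finite_graph_line)
  qed (rule inj, rule eq)
qed

lemma copies_path_graph: "copies n (path_graph x) = forest (replicate_mset n x)"
proof -
  have p: "graph_iso (path x) (path x)" by (simp add: graph_iso_refl finite_graph_path)
  have "copies n (path_graph x) = abs_unlabelled_graph (disjoint_copies n (path x))"
    by (simp add: path_graph.abs_eq copies.abs_eq[OF p])
  also have "\<dots> = abs_unlabelled_graph (line (layout (replicate n x)))"
    by (rule Quotient_rel_abs[OF Quotient_unlabelled_graph graph_iso_copies_path])
  also have "\<dots> = forest (replicate_mset n x)" by (simp flip: forest_mset mset_replicate)
  finally show ?thesis .
qed

section \<open>The Moebius function on linear forests\<close>

lemma sum_moebius_interval:
  fixes a b :: "'a :: locally_finite_order"
  assumes "a \<le> b"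
  shows "(\<Sum>c\<in>{a..b}. moebius a c) = (if a = b then 1 else 0)"
proof (cases "a = b")
  case True
  then show ?thesis by (simp add: moebius.simps)
next
  case False
  have "{a..b} = insert b {a..<b}" using assms by auto
  moreover have "finite {a..<b}"
    by (rule finite_subset[OF _ finite_interval[of a b]]) auto
  ultimately have "(\<Sum>c\<in>{a..b}. moebius a c) = moebius a b + (\<Sum>c\<in>{a..<b}. moebius a c)" by simp
  moreover have "moebius a b = - (\<Sum>c\<in>{a..<b}. moebius a c)"
    using False assms by (subst moebius.simps) auto
  ultimately show ?thesis using False by simp
qed

text \<open>Packings into \<open>b\<close> correspond bijectively to the graphs below
  \<open>forest b\<close>. Those not above \<open>ones n\<close> contribute 0, so the sum is the
  defining one over an interval.\<close>

lemma moebius_forest: "forest_moebius (\<lambda>M. moebius (forest (ones n)) (forest M)) n"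
proof
  fix b :: "nat multiset" assume b: "0 \<notin># b"
  let ?a = "forest (ones n)"
  have inj: "inj_on forest {c. packs c b}"
    using forest_inject packs_pos by (intro inj_onI) blast
  have img: "forest ` {c. packs c b} = {c. c \<le> forest b}" using le_forest_iff by auto
  have "finite {c. c \<le> forest b}" unfolding img[symmetric] using finite_packs by blast
  have "(\<Sum>c | packs c b. moebius ?a (forest c)) = (\<Sum>c | c \<le> forest b. moebius ?a c)"
    unfolding img[symmetric] sum.reindex[OF inj] by simp
  also have "\<dots> = (\<Sum>c\<in>{?a..forest b}. moebius ?a c)"
    using \<open>finite {c. c \<le> forest b}\<close>
    by (intro sum.mono_neutral_right) (auto simp: moebius.simps)
  also have "\<dots> = (if forest b = ?a then 1 else 0)"
    by (cases "?a \<le> forest b") (auto simp: sum_moebius_interval)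
  also have "forest b = ?a \<longleftrightarrow> b = ones n"
    using forest_inject[of b "ones n"] b by auto
  finally show "(\<Sum>c | packs c b. moebius ?a (forest c)) = (if b = ones n then 1 else 0)" .
qed

theorem theorem4p1:
  fixes n x :: nat
  assumes "n \<ge> 1" and "x \<ge> 1"
  shows "let \<mu> = moebius (copies n (path_graph 1)) (copies n (path_graph x)) in
      (n = 1 \<or> x = 4 \<longrightarrow> \<mu> = (-1) ^ (x + n)) \<and>
      (x = 1 \<or> x = 3 \<longrightarrow> \<mu> = 1) \<and>
      (x = 2 \<and> n > 1 \<longrightarrow> \<mu> = 0) \<and>
      (n = 2 \<and> x \<ge> 2 \<longrightarrow> \<mu> = int (fib (x - 2))) \<and>
      (x = 5 \<longrightarrow> rat_of_int \<mu> = catalan n)"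
proof -
  interpret forest_moebius "\<lambda>M. moebius (forest (ones n)) (forest M)" n
    by (rule moebius_forest)
  define \<mu> where "\<mu> = moebius (copies n (path_graph 1)) (copies n (path_graph x))"
  have \<mu>: "\<mu> = moebius (forest (ones n)) (forest (replicate_mset n x))"
    by (simp add: \<mu>_def copies_path_graph)
  \<comment> \<open>Size 1 lies outside both families of explicit solutions, but there the two
    forests coincide.\<close>
  have one: "\<mu> = 1" if "x = 1" using that by (simp add: \<mu> moebius.simps)
  have fib: "\<mu> = fib_weight (replicate_mset n x)" if "2 \<le> x" "n \<le> 2"
    unfolding \<mu> using that by (intro g_eq_fib_weight) (auto split: if_splits)
  have motz: "\<mu> = motzkin_weight (replicate_mset n x)" if "x \<in> {2..5}"
    unfolding \<mu> using that by (intro g_eq_motzkin_weight) (auto split: if_splits)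
  have "\<mu> = (-1) ^ (x + n)" if "n = 1"
    using one fib that assms by (cases "x = 1") auto
  \<comment> \<open>With equal components one argument at most is nonzero:
    \<open>motzkin 0 n 0\<close>, \<open>motzkin 0 0 n\<close> and \<open>motzkin n 0 0\<close>
    belong to sizes 4, 3 and 5. Several components of size 2 weigh 0.\<close>
  moreover have "\<mu> = (-1) ^ (x + n)" if "x = 4"
    using motz that by (simp add: motzkin_weight_def signed_motzkin_def power_add)
  moreover have "\<mu> = 1" if "x = 3"
    using motz that by (simp add: motzkin_weight_def signed_motzkin_def)
  moreover have "\<mu> = 0" if "x = 2" "n > 1"
    using motz that by (simp add: motzkin_weight_def)
  \<comment> \<open>For \<open>x = 1\<close> the index would be -1, with Fibonacci value 1, whereas
    truncated subtraction would give \<open>fib 0 = 0\<close>.\<close>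
  moreover have "\<mu> = int (fib (x - 2))" if "n = 2" "x \<ge> 2"
  proof -
    have "(- 1 :: int) ^ (x + x) = 1" by (simp flip: mult_2)
    then show ?thesis using fib that fib_weight_pair[of x x] by (simp add: numeral_2_eq_2)
  qed
  moreover have "rat_of_int \<mu> = catalan n" if "x = 5"
    using motz that motzkin_catalan[of n] by (simp add: motzkin_weight_def signed_motzkin_def)
  ultimately show ?thesis using one unfolding \<mu>_def[symmetric] Let_def by blast
qed

end
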